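(* Let $\mathsf{K}$ be an essentially small triangulated category. If $T(\mathsf{K})$ is a coherent frame and $(\mathrm{Spcnt}\,\mathsf{K})^\vee$ is noetherian, then there is a homeomorphism $\mathrm{MSpc}\,\mathsf{K}\cong(\mathrm{Spcnt}\,\mathsf{K})^\vee$.
   Context: $T(\mathsf{K})$ is the complete lattice of thick subcategories of $\mathsf{K}$ (full subcategories closed under isomorphisms, suspensions, cones and direct summands), ordered by inclusion; meets are intersections, and the join of a family is the smallest thick subcategory containing its union; $\mathrm{thick}(x)$ is the smallest thick subcategory containing $x$. A frame is a complete lattice in which finite meets distribute over arbitrary joins. An element $l$ is compact if $l\le\bigvee_{i\in I}m_i$ implies $l\le\bigvee_{i\in J}m_i$ for some finite $J\subseteq I$. A frame is coherent if its compact elements form a bounded sublattice (in particular the top is compact) and every element is a join of compact elements. $\mathrm{Spcnt}\,\mathsf{K}$ is the space of poset maps $p\colon T(\mathsf{K})\to\mathbf{2}=\{0\le1\}$ preserving finite meets and arbitrary joins, with opens $\{p\mid p(\mathsf{M})=1\}$ for $\mathsf{M}\in T(\mathsf{K})$. When $T(\mathsf{K})$ is a coherent frame this is a spectral space (quasi-compact, sober, with quasi-compact opens closed under finite intersections and forming a basis). For a spectral space $X$, the Hochster dual $X^\vee$ has the same points and has as a basis of opens the closed subsets of $X$ with quasi-compact open complement. A thick subcategory is finitely generated if it is of the form $\mathrm{thick}(k)$ for an object $k$. A thick subcategory $\mathsf{J}\neq 0$ is join-prime if $\mathsf{J}\subseteq\mathsf{A}\vee\mathsf{B}$ implies $\mathsf{J}\subseteq\mathsf{A}$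 or $\mathsf{J}\subseteq\mathsf{B}$. $\mathrm{MSpc}\,\mathsf{K}$ (Matsui's spectrum) is the set of finitely generated join-prime elements of $T(\mathsf{K})$, with the topology having as basic closed subsets the sets $Z_x=\{\mathsf{J}\in\mathrm{MSpc}\,\mathsf{K}\mid\mathsf{J}\subseteq\mathrm{thick}(x)\}$ for $x\in\mathsf{K}$. *)

theory Defs
  imports "HOL-Analysis.Abstract_Topology" "HOL-Algebra.Complete_Lattice" "HOL-Algebra.Group"
begin

section \<open>Triangulated categories\<close>

text \<open>
  A category is given by a set of objects and a set of arrows over arbitrary types, so it is small.
  Every essentially small category is equivalent to a small one, and the equivalence identifies the
  lattices of thick subcategories.
\<close>

record ('o, 'a) cat =
  Obj :: "'o set"
  Arr :: "'a set"
  src :: "'a \<Rightarrow> 'o"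
  tgt :: "'a \<Rightarrow> 'o"
  ident :: "'o \<Rightarrow> 'a"
  compo :: "'a \<Rightarrow> 'a \<Rightarrow> 'a"  (infixl \<open>\<cdot>\<index>\<close> 70)

definition homset :: "('o, 'a, 'm) cat_scheme \<Rightarrow> 'o \<Rightarrow> 'o \<Rightarrow> 'a set"
  where "homset C X Y = {f \<in> Arr C. src C f = X \<and> tgt C f = Y}"

locale category =
  fixes C (structure)
  assumes src_closed: "f \<in> Arr C \<Longrightarrow> src C f \<in> Obj C"
    and tgt_closed: "f \<in> Arr C \<Longrightarrow> tgt C f \<in> Obj C"
    and ident_hom: "X \<in> Obj C \<Longrightarrow> ident C X \<in> homset C X X"
    and compo_hom: "\<lbrakk>f \<in> homset C X Y; g \<in> homset C Y Z\<rbrakk> \<Longrightarrow> g \<cdot> f \<in> homset C X Z"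
    and ident_left: "f \<in> homset C X Y \<Longrightarrow> ident C Y \<cdot> f = f"
    and ident_right: "f \<in> homset C X Y \<Longrightarrow> f \<cdot> ident C X = f"
    and compo_assoc: "\<lbrakk>f \<in> homset C W X; g \<in> homset C X Y; h \<in> homset C Y Z\<rbrakk>
        \<Longrightarrow> (h \<cdot> g) \<cdot> f = h \<cdot> (g \<cdot> f)"

definition is_iso :: "('o, 'a, 'm) cat_scheme \<Rightarrow> 'a \<Rightarrow> bool"
  where "is_iso C f \<longleftrightarrow> f \<in> Arr C \<and>
    (\<exists>g \<in> homset C (tgt C f) (src C f).
      g \<cdot>\<^bsub>C\<^esub> f = ident C (src C f) \<and> f \<cdot>\<^bsub>C\<^esub> g = ident C (tgt C f))"

definition isomorphic_objs :: "('o, 'a, 'm) cat_scheme \<Rightarrow> 'o \<Rightarrow> 'o \<Rightarrow> bool"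
  where "isomorphic_objs C X Y \<longleftrightarrow> (\<exists>f \<in> homset C X Y. is_iso C f)"

definition zero_object :: "('o, 'a, 'm) cat_scheme \<Rightarrow> 'o \<Rightarrow> bool"
  where "zero_object C Z \<longleftrightarrow> Z \<in> Obj C \<and>
    (\<forall>X \<in> Obj C. (\<exists>!f. f \<in> homset C X Z) \<and> (\<exists>!f. f \<in> homset C Z X))"

record ('o, 'a) addcat = "('o, 'a) cat" +
  hadd :: "'a \<Rightarrow> 'a \<Rightarrow> 'a"
  hzero :: "'o \<Rightarrow> 'o \<Rightarrow> 'a"

definition hom_group :: "('o, 'a, 'm) addcat_scheme \<Rightarrow> 'o \<Rightarrow> 'o \<Rightarrow> 'a monoid"
  where "hom_group C X Y =
    \<lparr>carrier = homset C X Y, monoid.mult = hadd C, one = hzero C X Y\<rparr>"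

definition hneg :: "('o, 'a, 'm) addcat_scheme \<Rightarrow> 'a \<Rightarrow> 'a"
  where "hneg C f = inv\<^bsub>hom_group C (src C f) (tgt C f)\<^esub> f"

definition is_biproduct ::
    "('o, 'a, 'm) addcat_scheme \<Rightarrow> 'o \<Rightarrow> 'o \<Rightarrow> 'o \<Rightarrow> 'a \<Rightarrow> 'a \<Rightarrow> 'a \<Rightarrow> 'a \<Rightarrow> bool"
  where "is_biproduct C W X Y i j p q \<longleftrightarrow>
    W \<in> Obj C \<and> X \<in> Obj C \<and> Y \<in> Obj C \<and>
    i \<in> homset C X W \<and> j \<in> homset C Y W \<and> p \<in> homset C W X \<and> q \<in> homset C W Y \<and>
    p \<cdot>\<^bsub>C\<^esub> i = ident C X \<and> q \<cdot>\<^bsub>C\<^esub> j = ident C Y \<and>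
    q \<cdot>\<^bsub>C\<^esub> i = hzero C X Y \<and> p \<cdot>\<^bsub>C\<^esub> j = hzero C Y X \<and>
    hadd C (i \<cdot>\<^bsub>C\<^esub> p) (j \<cdot>\<^bsub>C\<^esub> q) = ident C W"

definition direct_summand :: "('o, 'a, 'm) addcat_scheme \<Rightarrow> 'o \<Rightarrow> 'o \<Rightarrow> bool"
  where "direct_summand C X W \<longleftrightarrow> (\<exists>Y i j p q. is_biproduct C W X Y i j p q)"

locale additive_category = category C for C (structure) +
  assumes hom_comm_group: "\<lbrakk>X \<in> Obj C; Y \<in> Obj C\<rbrakk> \<Longrightarrow> comm_group (hom_group C X Y)"
    and compo_hadd_left: "\<lbrakk>f \<in> homset C X Y; g \<in> homset C Y Z; h \<in> homset C Y Z\<rbrakk>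
        \<Longrightarrow> hadd C g h \<cdot> f = hadd C (g \<cdot> f) (h \<cdot> f)"
    and compo_hadd_right: "\<lbrakk>f \<in> homset C X Y; g \<in> homset C X Y; h \<in> homset C Y Z\<rbrakk>
        \<Longrightarrow> h \<cdot> hadd C f g = hadd C (h \<cdot> f) (h \<cdot> g)"
    and zero_object_exists: "\<exists>Z. zero_object C Z"
    and biproduct_exists: "\<lbrakk>X \<in> Obj C; Y \<in> Obj C\<rbrakk> \<Longrightarrow> \<exists>W i j p q. is_biproduct C W X Y i j p q"

text \<open>
  The triple \<open>(f, g, h)\<close> stands for the triangle \<open>X \<rightarrow> Y \<rightarrow> Z \<rightarrow> \<Sigma>X\<close>; the objects are recovered as
  sources and targets.
\<close>

record ('o, 'a) tricat = "('o, 'a) addcat" +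
  susp :: "'o \<Rightarrow> 'o"
  sarr :: "'a \<Rightarrow> 'a"
  dist :: "('a \<times> 'a \<times> 'a) set"

definition triangle :: "('o, 'a, 'm) tricat_scheme \<Rightarrow> 'a \<Rightarrow> 'a \<Rightarrow> 'a \<Rightarrow> bool"
  where "triangle K f g h \<longleftrightarrow> f \<in> Arr K \<and> g \<in> Arr K \<and> h \<in> Arr K \<and>
    src K g = tgt K f \<and> src K h = tgt K g \<and> tgt K h = susp K (src K f)"

definition triangle_morphism ::
    "('o, 'a, 'm) tricat_scheme \<Rightarrow> 'a \<times> 'a \<times> 'a \<Rightarrow> 'a \<times> 'a \<times> 'a \<Rightarrow> 'a \<Rightarrow> 'a \<Rightarrow> 'a \<Rightarrow> bool"
  where "triangle_morphism K = (\<lambda>(f, g, h) (f', g', h') u v w.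
    u \<in> homset K (src K f) (src K f') \<and>
    v \<in> homset K (src K g) (src K g') \<and>
    w \<in> homset K (src K h) (src K h') \<and>
    v \<cdot>\<^bsub>K\<^esub> f = f' \<cdot>\<^bsub>K\<^esub> u \<and> w \<cdot>\<^bsub>K\<^esub> g = g' \<cdot>\<^bsub>K\<^esub> v \<and> sarr K u \<cdot>\<^bsub>K\<^esub> h = h' \<cdot>\<^bsub>K\<^esub> w)"

text \<open>
  The suspension is an additive autoequivalence (not necessarily an automorphism); its fullness and
  faithfulness is \<open>sarr_bij\<close>, its essential surjectivity is \<open>susp_ess_surj\<close>.
\<close>

locale triangulated_category = additive_category K for K (structure) +
  assumes susp_closed: "X \<in> Obj K \<Longrightarrow> susp K X \<in> Obj K"
    and sarr_ident: "X \<in> Obj K \<Longrightarrow> sarr K (ident K X) = ident K (susp K X)"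
    and sarr_compo: "\<lbrakk>f \<in> homset K X Y; g \<in> homset K Y Z\<rbrakk> \<Longrightarrow> sarr K (g \<cdot> f) = sarr K g \<cdot> sarr K f"
    and sarr_hadd: "\<lbrakk>f \<in> homset K X Y; g \<in> homset K X Y\<rbrakk>
        \<Longrightarrow> sarr K (hadd K f g) = hadd K (sarr K f) (sarr K g)"
    and sarr_bij: "\<lbrakk>X \<in> Obj K; Y \<in> Obj K\<rbrakk>
        \<Longrightarrow> bij_betw (sarr K) (homset K X Y) (homset K (susp K X) (susp K Y))"
    and susp_ess_surj: "Y \<in> Obj K \<Longrightarrow> \<exists>X \<in> Obj K. isomorphic_objs K (susp K X) Y"
    and dist_triangle: "(f, g, h) \<in> dist K \<Longrightarrow> triangle K f g h"
    and dist_iso: "\<lbrakk>(f, g, h) \<in> dist K; triangle K f' g' h';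
          triangle_morphism K (f, g, h) (f', g', h') u v w; is_iso K u; is_iso K v; is_iso K w\<rbrakk>
        \<Longrightarrow> (f', g', h') \<in> dist K"
    and dist_ident: "\<lbrakk>X \<in> Obj K; zero_object K Z\<rbrakk>
        \<Longrightarrow> (ident K X, hzero K X Z, hzero K Z (susp K X)) \<in> dist K"
    and dist_extend: "f \<in> Arr K \<Longrightarrow> \<exists>g h. (f, g, h) \<in> dist K"
    and dist_rotate: "triangle K f g h
        \<Longrightarrow> (f, g, h) \<in> dist K \<longleftrightarrow> (g, h, hneg K (sarr K f)) \<in> dist K"
    and dist_morphism: "\<lbrakk>(f, g, h) \<in> dist K; (f', g', h') \<in> dist K;
          u \<in> homset K (src K f) (src K f'); v \<in> homset K (src K g) (src K g'); v \<cdot> f = f' \<cdot> u\<rbrakk>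
        \<Longrightarrow> \<exists>w. triangle_morphism K (f, g, h) (f', g', h') u v w"
    and octahedral: "\<lbrakk>f \<in> homset K X Y; g \<in> homset K Y Z;
          (f, f1, f2) \<in> dist K; (g, g1, g2) \<in> dist K; (g \<cdot> f, h1, h2) \<in> dist K\<rbrakk>
        \<Longrightarrow> \<exists>u v. (u, v, sarr K f1 \<cdot> g2) \<in> dist K \<and>
              u \<in> homset K (tgt K f1) (tgt K h1) \<and> v \<in> homset K (tgt K h1) (tgt K g1) \<and>
              u \<cdot> f1 = h1 \<cdot> g \<and> h2 \<cdot> u = f2 \<and> v \<cdot> h1 = g1 \<and> g2 \<cdot> v = sarr K f \<cdot> h2"


section \<open>Thick subcategories\<close>

text \<open>
  A full subcategory is identified with its set of objects. Closure under suspensions means closure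
  under the suspension functor and its quasi-inverse. The empty subcategory is not thick.
\<close>

definition thick_subcategory :: "('o, 'a, 'm) tricat_scheme \<Rightarrow> 'o set \<Rightarrow> bool"
  where "thick_subcategory K M \<longleftrightarrow> M \<subseteq> Obj K \<and>
    (\<forall>Z. zero_object K Z \<longrightarrow> Z \<in> M) \<and>
    (\<forall>X \<in> M. \<forall>Y \<in> Obj K. isomorphic_objs K X Y \<longrightarrow> Y \<in> M) \<and>
    (\<forall>X \<in> Obj K. X \<in> M \<longleftrightarrow> susp K X \<in> M) \<and>
    (\<forall>f g h. (f, g, h) \<in> dist K \<and> src K f \<in> M \<and> tgt K f \<in> M \<longrightarrow> tgt K g \<in> M) \<and>
    (\<forall>W \<in> M. \<forall>X. direct_summand K X W \<longrightarrow> X \<in> M)"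

definition thick_lattice :: "('o, 'a, 'm) tricat_scheme \<Rightarrow> 'o set gorder"
  where "thick_lattice K = \<lparr>carrier = {M. thick_subcategory K M}, eq = (=), le = (\<subseteq>)\<rparr>"

definition thick_closure :: "('o, 'a, 'm) tricat_scheme \<Rightarrow> 'o set \<Rightarrow> 'o set"
  where "thick_closure K S = \<Inter>{M. thick_subcategory K M \<and> S \<subseteq> M}"

abbreviation thick :: "('o, 'a, 'm) tricat_scheme \<Rightarrow> 'o \<Rightarrow> 'o set"
  where "thick K X \<equiv> thick_closure K {X}"

lemma thick_lattice_simps [simp]:
  "carrier (thick_lattice K) = {M. thick_subcategory K M}"
  "(.=\<^bsub>thick_lattice K\<^esub>) = (=)"
  "(\<sqsubseteq>\<^bsub>thick_lattice K\<^esub>) = (\<subseteq>)"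
  by (simp_all add: thick_lattice_def)

lemma thick_subcategory_subset: "thick_subcategory K M \<Longrightarrow> M \<subseteq> Obj K"
  unfolding thick_subcategory_def by (rule conjunct1)

lemma (in triangulated_category) thick_Obj: "thick_subcategory K (Obj K)"
  unfolding thick_subcategory_def
proof (intro conjI allI ballI impI)
  fix f g h assume "(f, g, h) \<in> dist K \<and> src K f \<in> Obj K \<and> tgt K f \<in> Obj K"
  then show "tgt K g \<in> Obj K"
    using dist_triangle tgt_closed unfolding triangle_def by blast
qed (simp_all add: zero_object_def direct_summand_def is_biproduct_def susp_closed, blast?)

lemma thick_Inter:
  assumes "S \<noteq> {}" "\<And>M. M \<in> S \<Longrightarrow> thick_subcategory K M"
  shows "thick_subcategory K (\<Inter>S)"
proof -
  note D = assms(2)[unfolded thick_subcategory_def]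
  have sub: "\<Inter>S \<subseteq> Obj K"
    using assms(1) D by blast
  have zero: "\<forall>Z. zero_object K Z \<longrightarrow> Z \<in> \<Inter>S"
    using D by blast
  have iso: "\<forall>X \<in> \<Inter>S. \<forall>Y \<in> Obj K. isomorphic_objs K X Y \<longrightarrow> Y \<in> \<Inter>S"
  proof (intro ballI impI InterI)
    fix X Y M assume "X \<in> \<Inter>S" "Y \<in> Obj K" "isomorphic_objs K X Y" "M \<in> S"
    with D[OF this(4)] show "Y \<in> M" by blast
  qed
  have susp: "\<forall>X \<in> Obj K. X \<in> \<Inter>S \<longleftrightarrow> susp K X \<in> \<Inter>S"
  proof
    fix X assume X: "X \<in> Obj K"
    have "X \<in> M \<longleftrightarrow> susp K X \<in> M" if "M \<in> S" for M
      using D[OF that] X by blast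
    then show "X \<in> \<Inter>S \<longleftrightarrow> susp K X \<in> \<Inter>S" by blast
  qed
  have cone: "\<forall>f g h. (f, g, h) \<in> dist K \<and> src K f \<in> \<Inter>S \<and> tgt K f \<in> \<Inter>S \<longrightarrow> tgt K g \<in> \<Inter>S"
  proof (intro allI impI InterI)
    fix f g h M assume "(f, g, h) \<in> dist K \<and> src K f \<in> \<Inter>S \<and> tgt K f \<in> \<Inter>S" "M \<in> S"
    with D[OF this(2)] show "tgt K g \<in> M" by blast
  qed
  have summand: "\<forall>W \<in> \<Inter>S. \<forall>X. direct_summand K X W \<longrightarrow> X \<in> \<Inter>S"
  proof (intro ballI allI impI InterI)
    fix W X M assume "W \<in> \<Inter>S" "direct_summand K X W" "M \<in> S"
    with D[OF this(3)] show "X \<in> M" by blast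
  qed
  show ?thesis
    unfolding thick_subcategory_def by (intro conjI sub zero iso susp cone summand)
qed

lemma (in triangulated_category) thick_closure_thick:
  "S \<subseteq> Obj K \<Longrightarrow> thick_subcategory K (thick_closure K S)"
  unfolding thick_closure_def using thick_Obj by (intro thick_Inter) auto

lemma partial_order_thick_lattice: "partial_order (thick_lattice K)"
  by unfold_locales auto

lemma (in triangulated_category) complete_lattice_thick_lattice:
  "complete_lattice (thick_lattice K)"
proof -
  interpret partial_order "thick_lattice K"
    by (rule partial_order_thick_lattice)
  show ?thesis
  proof
    fix A assume A: "A \<subseteq> carrier (thick_lattice K)"
    then have "\<Union>A \<subseteq> Obj K"
      using thick_subcategory_subset by fastforce
    then have "thick_subcategory K (thick_closure K (\<Union>A))"
      by (rule thick_closure_thick)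
    then have "least (thick_lattice K) (thick_closure K (\<Union>A)) (Upper (thick_lattice K) A)"
      using A by (auto simp: least_def Upper_def thick_closure_def)
    then show "\<exists>s. least (thick_lattice K) s (Upper (thick_lattice K) A)"
      by blast
    have "thick_subcategory K (\<Inter>(insert (Obj K) A))"
      using A thick_Obj by (intro thick_Inter) auto
    then have "greatest (thick_lattice K) (\<Inter>(insert (Obj K) A)) (Lower (thick_lattice K) A)"
      using A by (auto simp: greatest_def Lower_def dest: thick_subcategory_subset)
    then show "\<exists>i. greatest (thick_lattice K) i (Lower (thick_lattice K) A)"
      by blast
  qed
qed


section \<open>Coherent frames and their points\<close>

definition frame :: "('l, 'm) gorder_scheme \<Rightarrow> bool"
  where "frame L \<longleftrightarrow> complete_lattice L \<and>
    (\<forall>a \<in> carrier L. \<forall>S \<subseteq> carrier L. a \<sqinter>\<^bsub>L\<^esub> \<Squnion>\<^bsub>L\<^esub>S = \<Squnion>\<^bsub>L\<^esub>((\<lambda>s. a \<sqinter>\<^bsub>L\<^esub> s) ` S))"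

definition compact_element :: "('l, 'm) gorder_scheme \<Rightarrow> 'l \<Rightarrow> bool"
  where "compact_element L l \<longleftrightarrow> l \<in> carrier L \<and>
    (\<forall>S \<subseteq> carrier L. l \<sqsubseteq>\<^bsub>L\<^esub> \<Squnion>\<^bsub>L\<^esub>S \<longrightarrow> (\<exists>F \<subseteq> S. finite F \<and> l \<sqsubseteq>\<^bsub>L\<^esub> \<Squnion>\<^bsub>L\<^esub>F))"

definition coherent_frame :: "('l, 'm) gorder_scheme \<Rightarrow> bool"
  where "coherent_frame L \<longleftrightarrow> frame L \<and>
    compact_element L \<bottom>\<^bsub>L\<^esub> \<and> compact_element L \<top>\<^bsub>L\<^esub> \<and>
    (\<forall>a b. compact_element L a \<and> compact_element L b \<longrightarrow>
      compact_element L (a \<squnion>\<^bsub>L\<^esub> b) \<and> compact_element L (a \<sqinter>\<^bsub>L\<^esub> b)) \<and>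
    (\<forall>a \<in> carrier L. \<exists>S. (\<forall>s \<in> S. compact_element L s) \<and> a = \<Squnion>\<^bsub>L\<^esub>S)"

text \<open>
  The poset \<open>0 \<le> 1\<close> is \<^typ>\<open>bool\<close>, whose meets and joins are \<open>\<forall>\<close> and \<open>\<exists>\<close>. Points are
  extensional functions on the carrier, so that distinct points differ on some element of \<open>L\<close>.
\<close>

definition lattice_point :: "('l, 'm) gorder_scheme \<Rightarrow> ('l \<Rightarrow> bool) \<Rightarrow> bool"
  where "lattice_point L p \<longleftrightarrow> p \<in> extensional (carrier L) \<and>
    (\<forall>a \<in> carrier L. \<forall>b \<in> carrier L. a \<sqsubseteq>\<^bsub>L\<^esub> b \<longrightarrow> p a \<le> p b) \<and>
    (\<forall>F \<subseteq> carrier L. finite F \<longrightarrow> p (\<Sqinter>\<^bsub>L\<^esub>F) = (\<forall>a \<in> F. p a)) \<and>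
    (\<forall>S \<subseteq> carrier L. p (\<Squnion>\<^bsub>L\<^esub>S) = (\<exists>a \<in> S. p a))"

definition point_space :: "('l, 'm) gorder_scheme \<Rightarrow> ('l \<Rightarrow> bool) topology"
  where "point_space L = topology (\<lambda>U. \<exists>a \<in> carrier L. U = {p. lattice_point L p \<and> p a})"

lemma openin_point_space:
  assumes "complete_lattice L"
  shows "openin (point_space L) U \<longleftrightarrow> (\<exists>a \<in> carrier L. U = {p. lattice_point L p \<and> p a})"
proof -
  interpret complete_lattice L by (rule assms)
  let ?D = "\<lambda>a. {p. lattice_point L p \<and> p a}"
  have "istopology (\<lambda>U. \<exists>a \<in> carrier L. U = ?D a)"
    unfolding istopology_def
  proof (intro conjI allI impI)
    fix U V assume "\<exists>a \<in> carrier L. U = ?D a" "\<exists>a \<in> carrier L. V = ?D a"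
    then obtain a b where ab: "a \<in> carrier L" "b \<in> carrier L" "U = ?D a" "V = ?D b"
      by blast
    have "lattice_point L p \<Longrightarrow> p (\<Sqinter>\<^bsub>L\<^esub>{a, b}) = (\<forall>c \<in> {a, b}. p c)" for p
      using ab unfolding lattice_point_def by (meson empty_subsetI finite.intros insert_subset)
    then have "U \<inter> V = ?D (\<Sqinter>\<^bsub>L\<^esub>{a, b})"
      using ab by auto
    then show "\<exists>c \<in> carrier L. U \<inter> V = ?D c"
      using ab inf_closed[of "{a, b}"] by blast
  next
    fix \<U> assume U: "\<forall>U \<in> \<U>. \<exists>a \<in> carrier L. U = ?D a"
    let ?S = "{a \<in> carrier L. ?D a \<in> \<U>}"
    have S: "?S \<subseteq> carrier L" by (rule Collect_restrict)
    have eq: "p (\<Squnion>\<^bsub>L\<^esub>?S) = (\<exists>c \<in> ?S. p c)" if "lattice_point L p" for p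
      using that[unfolded lattice_point_def, THEN conjunct2, THEN conjunct2, THEN conjunct2,
          rule_format, OF S] .
    have "\<Union>\<U> = (\<Union>a \<in> ?S. ?D a)"
    proof
      show "\<Union>\<U> \<subseteq> (\<Union>a \<in> ?S. ?D a)"
      proof
        fix p assume "p \<in> \<Union>\<U>"
        then obtain U where "U \<in> \<U>" "p \<in> U" by (rule UnionE)
        moreover from bspec[OF U this(1)] obtain a where "a \<in> carrier L" "U = ?D a"
          by (rule bexE)
        ultimately show "p \<in> (\<Union>a \<in> ?S. ?D a)"
          by (intro UN_I[of a]) simp_all
      qed
    qed (rule UN_least, simp add: Union_upper)
    also have "\<dots> = ?D (\<Squnion>\<^bsub>L\<^esub>?S)"
    proof (rule Set.set_eqI)
      fix p
      show "p \<in> (\<Union>a \<in> ?S. ?D a) \<longleftrightarrow> p \<in> ?D (\<Squnion>\<^bsub>L\<^esub>?S)"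
      proof (cases "lattice_point L p")
        case True
        then show ?thesis unfolding UN_iff mem_Collect_eq[of p] eq[OF True] by simp
      qed simp
    qed
    finally have "\<Union>\<U> = ?D (\<Squnion>\<^bsub>L\<^esub>?S)" .
    moreover have "\<Squnion>\<^bsub>L\<^esub>?S \<in> carrier L"
      by (rule sup_closed) auto
    ultimately show "\<exists>a \<in> carrier L. \<Union>\<U> = ?D a"
      by blast
  qed
  then show ?thesis
    by (simp add: point_space_def topology_inverse')
qed

definition Spcnt :: "('o, 'a, 'm) tricat_scheme \<Rightarrow> ('o set \<Rightarrow> bool) topology"
  where "Spcnt K = point_space (thick_lattice K)"


section \<open>Hochster duals and noetherian spaces\<close>

definition hochster_basic :: "'p topology \<Rightarrow> 'p set \<Rightarrow> bool"
  where "hochster_basic X C \<longleftrightarrow> closedin X C \<and> compactin X (topspace X - C)"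

definition hochster_dual :: "'p topology \<Rightarrow> 'p topology"
  where "hochster_dual X = topology (arbitrary union_of hochster_basic X)"

lemma openin_hochster_dual:
  "openin (hochster_dual X) = arbitrary union_of hochster_basic X"
proof -
  have "hochster_basic X (A \<inter> B)" if "hochster_basic X A" "hochster_basic X B" for A B
    using that by (auto simp: hochster_basic_def Diff_Int intro: compactin_Un)
  then have "istopology (arbitrary union_of hochster_basic X)"
    by (intro istopology_base) blast
  then show ?thesis
    by (simp add: hochster_dual_def topology_inverse')
qed

lemma topspace_hochster_dual: "topspace (hochster_dual X) = topspace X"
proof
  have "hochster_basic X (topspace X)"
    by (simp add: hochster_basic_def)
  then show "topspace X \<subseteq> topspace (hochster_dual X)"
    by (metis openin_hochster_dual arbitrary_union_of_inc openin_subset)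
  obtain \<U> where "\<U> \<subseteq> Collect (hochster_basic X)" "\<Union>\<U> = topspace (hochster_dual X)"
    using openin_topspace[of "hochster_dual X"]
    unfolding openin_hochster_dual union_of_def by blast
  moreover have "V \<subseteq> topspace X" if "hochster_basic X V" for V
    using that closedin_subset unfolding hochster_basic_def by blast
  ultimately show "topspace (hochster_dual X) \<subseteq> topspace X"
    by (metis Sup_least mem_Collect_eq subsetD)
qed

definition noetherian_space :: "'p topology \<Rightarrow> bool"
  where "noetherian_space X \<longleftrightarrow>
    (\<forall>C :: nat \<Rightarrow> 'p set. (\<forall>n. closedin X (C n)) \<and> decseq C \<longrightarrow> (\<exists>N. \<forall>n \<ge> N. C n = C N))"


section \<open>Matsui's spectrum\<close>

definition join_prime :: "('o, 'a, 'm) tricat_scheme \<Rightarrow> 'o set \<Rightarrow> bool"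
  where "join_prime K J \<longleftrightarrow> thick_subcategory K J \<and> J \<noteq> {X. zero_object K X} \<and>
    (\<forall>A B. thick_subcategory K A \<and> thick_subcategory K B \<and> J \<subseteq> A \<squnion>\<^bsub>thick_lattice K\<^esub> B
      \<longrightarrow> J \<subseteq> A \<or> J \<subseteq> B)"

definition MSpc_points :: "('o, 'a, 'm) tricat_scheme \<Rightarrow> 'o set set"
  where "MSpc_points K = {J. (\<exists>k \<in> Obj K. J = thick K k) \<and> join_prime K J}"

definition MSpc_basic_closed :: "('o, 'a, 'm) tricat_scheme \<Rightarrow> 'o \<Rightarrow> 'o set set"
  where "MSpc_basic_closed K x = {J \<in> MSpc_points K. J \<subseteq> thick K x}"

text \<open>
  Join-primeness gives \<open>Z\<^sub>x \<union> Z\<^sub>y = Z\<^bsub>x \<oplus> y\<^esub>\<close> and \<open>Z\<^sub>0 = {}\<close>, so the complements of the sets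
  \<open>Z\<^sub>x\<close> are closed under finite intersections and generate the topology as a basis, with underlying
  set \<^term>\<open>MSpc_points K\<close>.
\<close>

definition MSpc :: "('o, 'a, 'm) tricat_scheme \<Rightarrow> 'o set topology"
  where "MSpc K =
    topology_generated_by {MSpc_points K - MSpc_basic_closed K x | x. x \<in> Obj K}"

end

theory Submission
  imports Defs
begin

text \<open>
  A point \<open>p\<close> of a frame is determined by the filter of the elements that it sends to \<open>1\<close>. If this
  filter is principal, generated by \<open>J\<close>, then preservation of joins says exactly that \<open>J\<close> is compact
  and join-prime; conversely \<open>M \<mapsto> (J \<subseteq> M)\<close> is a point for every compact join-prime \<open>J\<close>. The
  noetherian hypothesis makes every point of \<open>T(K)\<close> principal, and Matsui's points are exactly the
  compact join-primes of \<open>T(K)\<close>; this is the bijection.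
  
  Every point is principal for the following reason (\<open>noetherian_point_principal\<close>). The sets
  \<open>U(c) = {q | q c}\<close> with \<open>c\<close> compact are closed in the Hochster dual. Among those that contain a point \<open>p\<close>
  there is a minimal one, \<open>U(c)\<close>, by the descending chain condition. It is the least one, since
  \<open>U(c) \<inter> U(d) = U(c \<sqinter> d)\<close> and compact elements are closed under binary meets. A frame has enough
  points to separate a compact element from any element that is not above it (\<open>compact_separation\<close>,
  by Zorn's lemma), so \<open>c\<close> is the least compact element with \<open>p c\<close>. As every element is a join of
  compact ones, \<open>p a\<close> holds iff \<open>c \<sqsubseteq> a\<close>.
  
  In \<open>T(K)\<close> each \<open>thick(k)\<close> is compact, because directed unions of thick subcategories are thick. A
  compact join-prime \<open>J\<close> is the join of the \<open>thick(k)\<close> with \<open>k \<in> J\<close>, so the associated point holds at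
  one of them, which is then all of \<open>J\<close> (\<open>lattice_point_join_prime\<close>). The bottom of \<open>T(K)\<close> consists of
  the zero objects (\<open>thick_zero_objects\<close>), which matches the condition \<open>J \<noteq> 0\<close> with the condition that
  a point sends the bottom to \<open>0\<close>.
  
  Under the bijection \<open>Z\<^sub>x\<close> corresponds to \<open>U(thick(x))\<close>. These sets are closed in the Hochster dual. In
  the other direction, a quasi-compact open \<open>U(M)\<close> is covered by finitely many of the \<open>U(thick(x))\<close> with
  \<open>x \<in> M\<close>, so it is a finite union of them. Hence the two topologies agree.
\<close>


section \<open>Points of coherent frames\<close>

abbreviation point_open :: "('l, 'm) gorder_scheme \<Rightarrow> 'l \<Rightarrow> ('l \<Rightarrow> bool) set"
  where "point_open L a \<equiv> {p. lattice_point L p \<and> p a}"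

lemma compact_element_carrier: "compact_element L c \<Longrightarrow> c \<in> carrier L"
  by (simp add: compact_element_def)

lemma compact_elementD:
  assumes "compact_element L c" "S \<subseteq> carrier L" "c \<sqsubseteq>\<^bsub>L\<^esub> \<Squnion>\<^bsub>L\<^esub>S"
  obtains F where "F \<subseteq> S" "finite F" "c \<sqsubseteq>\<^bsub>L\<^esub> \<Squnion>\<^bsub>L\<^esub>F"
  using assms unfolding compact_element_def by blast

lemma frame_complete_lattice: "frame L \<Longrightarrow> complete_lattice L"
  by (simp add: frame_def)

lemma coherent_frame_frame: "coherent_frame L \<Longrightarrow> frame L"
  by (simp add: coherent_frame_def)

lemma coherent_frame_meet:
  "\<lbrakk>coherent_frame L; compact_element L a; compact_element L b\<rbrakk> \<Longrightarrow> compact_element L (a \<sqinter>\<^bsub>L\<^esub> b)"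
  by (simp add: coherent_frame_def)

lemma lattice_point_mono:
  "\<lbrakk>lattice_point L p; a \<in> carrier L; b \<in> carrier L; a \<sqsubseteq>\<^bsub>L\<^esub> b; p a\<rbrakk> \<Longrightarrow> p b"
  unfolding lattice_point_def by (simp add: le_bool_def)

lemma lattice_point_Inf:
  "\<lbrakk>lattice_point L p; F \<subseteq> carrier L; finite F\<rbrakk> \<Longrightarrow> p (\<Sqinter>\<^bsub>L\<^esub>F) \<longleftrightarrow> (\<forall>a \<in> F. p a)"
  unfolding lattice_point_def by blast

lemma lattice_point_Sup:
  "\<lbrakk>lattice_point L p; S \<subseteq> carrier L\<rbrakk> \<Longrightarrow> p (\<Squnion>\<^bsub>L\<^esub>S) \<longleftrightarrow> (\<exists>a \<in> S. p a)"
  unfolding lattice_point_def by blast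

lemma lattice_point_meet:
  "\<lbrakk>lattice_point L p; a \<in> carrier L; b \<in> carrier L\<rbrakk> \<Longrightarrow> p (a \<sqinter>\<^bsub>L\<^esub> b) \<longleftrightarrow> p a \<and> p b"
  using lattice_point_Inf[of L p "{a, b}"] by (simp add: meet_def)

lemma lattice_point_join:
  "\<lbrakk>lattice_point L p; a \<in> carrier L; b \<in> carrier L\<rbrakk> \<Longrightarrow> p (a \<squnion>\<^bsub>L\<^esub> b) \<longleftrightarrow> p a \<or> p b"
  using lattice_point_Sup[of L p "{a, b}"] by (simp add: join_def)

lemma (in complete_lattice) Inf_insert:
  "\<lbrakk>a \<in> carrier L; A \<subseteq> carrier L\<rbrakk> \<Longrightarrow> \<Sqinter>(insert a A) = a \<sqinter> \<Sqinter>A"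
  using weak_inf_insert eq_is_equal by simp

lemma (in complete_lattice) Sup_insert:
  "\<lbrakk>a \<in> carrier L; A \<subseteq> carrier L\<rbrakk> \<Longrightarrow> \<Squnion>(insert a A) = a \<squnion> \<Squnion>A"
  using weak_sup_insert eq_is_equal by simp

lemma (in complete_lattice) Sup_le_iff:
  "\<lbrakk>A \<subseteq> carrier L; b \<in> carrier L\<rbrakk> \<Longrightarrow> \<Squnion>A \<sqsubseteq> b \<longleftrightarrow> (\<forall>a \<in> A. a \<sqsubseteq> b)"
  by (meson le_trans subsetD sup_closed sup_least sup_upper)

lemma (in complete_lattice) le_Inf_iff:
  "\<lbrakk>A \<subseteq> carrier L; b \<in> carrier L\<rbrakk> \<Longrightarrow> b \<sqsubseteq> \<Sqinter>A \<longleftrightarrow> (\<forall>a \<in> A. b \<sqsubseteq> a)"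
  by (meson le_trans subsetD inf_closed inf_greatest inf_lower)

lemma (in complete_lattice) le_meet_iff:
  "\<lbrakk>a \<in> carrier L; b \<in> carrier L; x \<in> carrier L\<rbrakk> \<Longrightarrow> x \<sqsubseteq> a \<sqinter> b \<longleftrightarrow> x \<sqsubseteq> a \<and> x \<sqsubseteq> b"
  using le_Inf_iff[of "{a, b}" x] by (simp add: meet_def)

text \<open>
  Compactness reduces the chain to a finite subset, and such a subset has an upper bound in the chain.
\<close>

lemma (in complete_lattice) compact_le_chain_SupE:
  assumes c: "compact_element L c" and S: "S \<subseteq> carrier L" "S \<noteq> {}"
    and chain: "\<And>a b. a \<in> S \<Longrightarrow> b \<in> S \<Longrightarrow> a \<sqsubseteq> b \<or> b \<sqsubseteq> a"
    and le: "c \<sqsubseteq> \<Squnion>S"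
  obtains a where "a \<in> S" "c \<sqsubseteq> a"
proof -
  obtain F where F: "F \<subseteq> S" "finite F" "c \<sqsubseteq> \<Squnion>F"
    using compact_elementD[OF c S(1) le] .
  have "\<exists>a \<in> S. \<forall>b \<in> F. b \<sqsubseteq> a"
    using F(2,1)
  proof (induction F)
    case (insert x F)
    then obtain a where a: "a \<in> S" "\<forall>b \<in> F. b \<sqsubseteq> a" by auto
    have x: "x \<in> S" "F \<subseteq> carrier L" using insert S by auto
    show ?case
    proof (cases "a \<sqsubseteq> x")
      case True
      then have "\<forall>b \<in> insert x F. b \<sqsubseteq> x"
        using a x S le_refl[of x] le_trans[of _ a x] by (auto simp: subset_iff)
      then show ?thesis using x by blast
    next
      case False
      then have "x \<sqsubseteq> a" using chain a x by blast
      then show ?thesis using a by auto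
    qed
  qed (use S in auto)
  then obtain a where a: "a \<in> S" "\<forall>b \<in> F. b \<sqsubseteq> a" by blast
  then have "\<Squnion>F \<sqsubseteq> a"
    using F S by (intro sup_least) auto
  then have "c \<sqsubseteq> a"
    using le_trans[OF F(3)] F(1) a S compact_element_carrier[OF c] by (auto simp: subset_iff)
  with a show ?thesis using that by blast
qed

text \<open>
  The elements sent to \<open>0\<close> by a point form a principal ideal, generated by their join; the possible
  generators are the proper meet-prime elements.
\<close>

lemma lattice_point_of_meet_prime:
  fixes L (structure)
  assumes "complete_lattice L" and m: "m \<in> carrier L" "\<not> \<top>\<^bsub>L\<^esub> \<sqsubseteq>\<^bsub>L\<^esub> m"
    and prime: "\<And>a b. \<lbrakk>a \<in> carrier L; b \<in> carrier L; a \<sqinter>\<^bsub>L\<^esub> b \<sqsubseteq>\<^bsub>L\<^esub> m\<rbrakk> \<Longrightarrow> a \<sqsubseteq>\<^bsub>L\<^esub> m \<or> b \<sqsubseteq>\<^bsub>L\<^esub> m"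
  shows "lattice_point L (\<lambda>a \<in> carrier L. \<not> a \<sqsubseteq>\<^bsub>L\<^esub> m)"
proof -
  interpret complete_lattice L by (rule assms(1))
  have mono: "a \<sqsubseteq> m" if "a \<in> carrier L" "b \<in> carrier L" "a \<sqsubseteq> b" "b \<sqsubseteq> m" for a b
    using that m by (meson le_trans)
  have meet: "\<Sqinter>F \<sqsubseteq> m \<longleftrightarrow> (\<exists>a \<in> F. a \<sqsubseteq> m)" if "finite F" "F \<subseteq> carrier L" for F
    using that
  proof (induction F)
    case empty
    then show ?case using m weak_inf_empty by (simp add: eq_is_equal)
  next
    case (insert x F)
    have "x \<sqinter> \<Sqinter>F \<sqsubseteq> m \<longleftrightarrow> x \<sqsubseteq> m \<or> \<Sqinter>F \<sqsubseteq> m"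
      using insert prime[of x "\<Sqinter>F"] mono[of "x \<sqinter> \<Sqinter>F" x] mono[of "x \<sqinter> \<Sqinter>F" "\<Sqinter>F"]
        meet_left[of x "\<Sqinter>F"] meet_right[of x "\<Sqinter>F"] by auto
    then show ?case using insert by (simp add: Inf_insert)
  qed
  show ?thesis
    unfolding lattice_point_def
  proof (intro conjI ballI allI impI)
    show "(\<lambda>a \<in> carrier L. \<not> a \<sqsubseteq> m) a \<le> (\<lambda>a \<in> carrier L. \<not> a \<sqsubseteq> m) b"
      if "a \<in> carrier L" "b \<in> carrier L" "a \<sqsubseteq> b" for a b
      using that mono[of a b] by (auto simp: le_bool_def)
    show "(\<lambda>a \<in> carrier L. \<not> a \<sqsubseteq> m) (\<Sqinter>F) = (\<forall>a \<in> F. (\<lambda>a \<in> carrier L. \<not> a \<sqsubseteq> m) a)"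
      if "F \<subseteq> carrier L" "finite F" for F
      using that meet[of F] by (simp add: subset_iff)
    show "(\<lambda>a \<in> carrier L. \<not> a \<sqsubseteq> m) (\<Squnion>S) = (\<exists>a \<in> S. (\<lambda>a \<in> carrier L. \<not> a \<sqsubseteq> m) a)"
      if "S \<subseteq> carrier L" for S
      using that Sup_le_iff[OF that m(1)] by (auto simp: subset_iff)
  qed simp
qed

text \<open>
  Meets are preserved by any principal filter. Compactness of the generator reduces arbitrary joins to
  finite ones, and join-primeness handles those; the empty join is the reason for excluding the bottom.
\<close>

lemma lattice_point_of_join_prime:
  fixes L (structure)
  assumes "complete_lattice L" and j: "compact_element L j" "\<not> j \<sqsubseteq>\<^bsub>L\<^esub> \<bottom>\<^bsub>L\<^esub>"
    and prime: "\<And>a b. \<lbrakk>a \<in> carrier L; b \<in> carrier L; j \<sqsubseteq>\<^bsub>L\<^esub> a \<squnion>\<^bsub>L\<^esub> b\<rbrakk> \<Longrightarrow> j \<sqsubseteq>\<^bsub>L\<^esub> a \<or> j \<sqsubseteq>\<^bsub>L\<^esub> b"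
  shows "lattice_point L (\<lambda>a \<in> carrier L. j \<sqsubseteq>\<^bsub>L\<^esub> a)"
proof -
  interpret complete_lattice L by (rule assms(1))
  have jc: "j \<in> carrier L" using j by (simp add: compact_element_carrier)
  have fin: "\<exists>a \<in> F. j \<sqsubseteq> a" if "finite F" "F \<subseteq> carrier L" "j \<sqsubseteq> \<Squnion>F" for F
    using that
  proof (induction F)
    case empty
    then show ?case using j weak_sup_empty by (simp add: eq_is_equal)
  next
    case (insert x F)
    have F: "x \<in> carrier L" "F \<subseteq> carrier L" using insert.prems by auto
    then have "j \<sqsubseteq> x \<or> j \<sqsubseteq> \<Squnion>F"
      using prime[OF F(1) sup_closed[OF F(2)]] insert.prems by (simp add: Sup_insert)
    then show ?case using insert.IH F by blast
  qed
  have join: "j \<sqsubseteq> \<Squnion>S \<longleftrightarrow> (\<exists>a \<in> S. j \<sqsubseteq> a)" if S: "S \<subseteq> carrier L" for S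
  proof
    assume "j \<sqsubseteq> \<Squnion>S"
    then obtain F where F: "F \<subseteq> S" "finite F" "j \<sqsubseteq> \<Squnion>F"
      using compact_elementD[OF j(1) S] by blast
    then show "\<exists>a \<in> S. j \<sqsubseteq> a"
      using fin[of F] S by blast
  next
    assume "\<exists>a \<in> S. j \<sqsubseteq> a"
    then show "j \<sqsubseteq> \<Squnion>S"
      using le_trans[OF _ sup_upper[OF S] jc _ sup_closed[OF S]] S by blast
  qed
  have mono: "j \<sqsubseteq> b" if "a \<in> carrier L" "b \<in> carrier L" "a \<sqsubseteq> b" "j \<sqsubseteq> a" for a b
    using le_trans[OF that(4,3) jc that(1,2)] .
  show ?thesis
    unfolding lattice_point_def
  proof (intro conjI ballI allI impI)
    show "(\<lambda>a \<in> carrier L. j \<sqsubseteq> a) a \<le> (\<lambda>a \<in> carrier L. j \<sqsubseteq> a) b"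
      if "a \<in> carrier L" "b \<in> carrier L" "a \<sqsubseteq> b" for a b
      using that mono[of a b] by (auto simp: le_bool_def)
    show "(\<lambda>a \<in> carrier L. j \<sqsubseteq> a) (\<Sqinter>F) = (\<forall>a \<in> F. (\<lambda>a \<in> carrier L. j \<sqsubseteq> a) a)"
      if "F \<subseteq> carrier L" "finite F" for F
      using that le_Inf_iff[OF that(1) jc] by (simp add: subset_iff)
    show "(\<lambda>a \<in> carrier L. j \<sqsubseteq> a) (\<Squnion>S) = (\<exists>a \<in> S. (\<lambda>a \<in> carrier L. j \<sqsubseteq> a) a)"
      if "S \<subseteq> carrier L" for S
      using that join[OF that] by (auto simp: subset_iff)
  qed simp
qed

lemma frame_distrib:
  assumes "frame L" "a \<in> carrier L" "x \<in> carrier L" "y \<in> carrier L"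
  shows "a \<sqinter>\<^bsub>L\<^esub> (x \<squnion>\<^bsub>L\<^esub> y) = (a \<sqinter>\<^bsub>L\<^esub> x) \<squnion>\<^bsub>L\<^esub> (a \<sqinter>\<^bsub>L\<^esub> y)"
proof -
  have "a \<sqinter>\<^bsub>L\<^esub> \<Squnion>\<^bsub>L\<^esub>{x, y} = \<Squnion>\<^bsub>L\<^esub>((\<lambda>s. a \<sqinter>\<^bsub>L\<^esub> s) ` {x, y})"
    using assms unfolding frame_def by (metis empty_subsetI insert_subset)
  then show ?thesis by (simp add: join_def)
qed

text \<open>
  If neither \<open>a\<close> nor \<open>b\<close> were below \<open>m\<close>, then \<open>c\<close> would be below \<open>m \<squnion> a\<close> and \<open>m \<squnion> b\<close> by maximality,
  hence below \<open>(m \<squnion> a) \<sqinter> (m \<squnion> b) = m \<squnion> (a \<sqinter> b) = m\<close> by distributivity.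
\<close>

lemma maximal_not_above_prime:
  fixes L (structure)
  assumes fr: "frame L" and c: "c \<in> carrier L" and m: "m \<in> carrier L" "\<not> c \<sqsubseteq>\<^bsub>L\<^esub> m"
    and max: "\<And>n. \<lbrakk>n \<in> carrier L; m \<sqsubseteq>\<^bsub>L\<^esub> n; \<not> c \<sqsubseteq>\<^bsub>L\<^esub> n\<rbrakk> \<Longrightarrow> n = m"
    and ab: "a \<in> carrier L" "b \<in> carrier L" "a \<sqinter>\<^bsub>L\<^esub> b \<sqsubseteq>\<^bsub>L\<^esub> m"
  shows "a \<sqsubseteq>\<^bsub>L\<^esub> m \<or> b \<sqsubseteq>\<^bsub>L\<^esub> m"
proof (rule ccontr)
  interpret complete_lattice L by (rule frame_complete_lattice[OF fr])
  have above: "c \<sqsubseteq> m \<squnion> x" if "x \<in> carrier L" "\<not> x \<sqsubseteq> m" for x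
    using that m max[of "m \<squnion> x"] join_left[of m x] join_right[of m x] join_closed[of m x] by auto
  assume "\<not> (a \<sqsubseteq> m \<or> b \<sqsubseteq> m)"
  then have "c \<sqsubseteq> m \<squnion> a" "c \<sqsubseteq> m \<squnion> b"
    using above ab by auto
  then have "c \<sqsubseteq> (m \<squnion> a) \<sqinter> (m \<squnion> b)"
    using c m ab by (simp add: le_meet_iff)
  moreover have "(m \<squnion> a) \<sqinter> (m \<squnion> b) \<sqsubseteq> m"
  proof -
    have "(m \<squnion> a) \<sqinter> m \<sqsubseteq> m"
      using m ab by (simp add: meet_right)
    moreover have "(m \<squnion> a) \<sqinter> b \<sqsubseteq> m"
    proof -
      have "b \<sqinter> m \<sqsubseteq> m" "b \<sqinter> a \<sqsubseteq> m"
        using m ab by (auto simp: meet_right meet_comm)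
      then have "(b \<sqinter> m) \<squnion> (b \<sqinter> a) \<sqsubseteq> m"
        using m ab by (intro join_le) auto
      then show ?thesis
        using frame_distrib[OF fr, of b m a] m ab by (simp add: meet_comm)
    qed
    ultimately show ?thesis
      using frame_distrib[OF fr, of "m \<squnion> a" m b] m ab by (simp add: join_le)
  qed
  ultimately have "c \<sqsubseteq> m"
    using c m ab by (meson join_closed le_trans meet_closed)
  with m show False by blast
qed

text \<open>
  The elements above \<open>b\<close> but not above \<open>c\<close> have a maximal member, because \<open>c\<close> is compact; it is
  meet-prime and gives the point. This is the prime ideal theorem in frame form.
\<close>

lemma compact_separation:
  fixes L (structure)
  assumes fr: "frame L" and c: "compact_element L c" and b: "b \<in> carrier L" "\<not> c \<sqsubseteq>\<^bsub>L\<^esub> b"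
  obtains p where "lattice_point L p" "p c" "\<not> p b"
proof -
  interpret complete_lattice L by (rule frame_complete_lattice[OF fr])
  have cc: "c \<in> carrier L" using c by (rule compact_element_carrier)
  let ?A = "{m \<in> carrier L. b \<sqsubseteq> m \<and> \<not> c \<sqsubseteq> m}"
  have "\<exists>m \<in> ?A. \<forall>n \<in> ?A. m \<sqsubseteq> n \<longrightarrow> n = m"
  proof (rule predicate_Zorn)
    show "partial_order_on ?A (relation_of (\<sqsubseteq>) ?A)"
      unfolding partial_order_on_def preorder_on_def refl_on_def trans_def antisym_def relation_of_def
      by (auto intro: le_trans le_antisym)
    fix C assume "C \<in> Chains (relation_of (\<sqsubseteq>) ?A)"
    then have C: "C \<subseteq> ?A" "\<And>x y. x \<in> C \<Longrightarrow> y \<in> C \<Longrightarrow> x \<sqsubseteq> y \<or> y \<sqsubseteq> x"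
      unfolding Chains_def relation_of_def by auto
    \<comment> \<open>Adding \<open>b\<close> covers the empty chain, whose join need not lie above \<open>b\<close>.\<close>
    have S: "insert b C \<subseteq> carrier L" using C b by auto
    have chain: "x \<sqsubseteq> y \<or> y \<sqsubseteq> x" if "x \<in> insert b C" "y \<in> insert b C" for x y
      using that C(1) C(2)[of x y] b le_refl[OF b(1)] by auto
    have "\<not> c \<sqsubseteq> \<Squnion>(insert b C)"
    proof
      assume "c \<sqsubseteq> \<Squnion>(insert b C)"
      then obtain a where "a \<in> insert b C" "c \<sqsubseteq> a"
        using compact_le_chain_SupE[OF c S _ chain] by blast
      then show False using C b by auto
    qed
    then have "\<Squnion>(insert b C) \<in> ?A"
      using S by (auto intro!: sup_upper)
    moreover have "\<forall>a \<in> C. a \<sqsubseteq> \<Squnion>(insert b C)"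
      using S by (auto intro!: sup_upper)
    ultimately show "\<exists>u \<in> ?A. \<forall>a \<in> C. a \<sqsubseteq> u" by blast
  qed
  then obtain m where m: "m \<in> carrier L" "b \<sqsubseteq> m" "\<not> c \<sqsubseteq> m"
    and max: "\<And>n. \<lbrakk>n \<in> carrier L; b \<sqsubseteq> n; \<not> c \<sqsubseteq> n; m \<sqsubseteq> n\<rbrakk> \<Longrightarrow> n = m"
    by auto
  have max': "n = m" if "n \<in> carrier L" "m \<sqsubseteq> n" "\<not> c \<sqsubseteq> n" for n
    using that max[of n] m b by (meson le_trans)
  have "\<not> \<top> \<sqsubseteq> m"
    using m cc by (meson le_trans top_closed top_higher)
  then have "lattice_point L (\<lambda>a \<in> carrier L. \<not> a \<sqsubseteq> m)"
    using maximal_not_above_prime[OF fr cc m(1,3) max'] m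
    by (intro lattice_point_of_meet_prime complete_lattice_axioms) auto
  then show ?thesis
    using m b cc by (intro that[of "\<lambda>a \<in> carrier L. \<not> a \<sqsubseteq> m"]) auto
qed

lemma point_open_subset_iff:
  assumes "frame L" "compact_element L c" "b \<in> carrier L"
  shows "point_open L c \<subseteq> point_open L b \<longleftrightarrow> c \<sqsubseteq>\<^bsub>L\<^esub> b"
proof
  assume "point_open L c \<subseteq> point_open L b"
  then show "c \<sqsubseteq>\<^bsub>L\<^esub> b"
    using compact_separation[OF assms] by blast
next
  assume "c \<sqsubseteq>\<^bsub>L\<^esub> b"
  then show "point_open L c \<subseteq> point_open L b"
    using lattice_point_mono[OF _ compact_element_carrier[OF assms(2)] assms(3)] by blast
qed

lemma topspace_point_space:
  fixes L (structure)
  assumes "complete_lattice L"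
  shows "topspace (point_space L) = {p. lattice_point L p}"
proof
  show "topspace (point_space L) \<subseteq> {p. lattice_point L p}"
    using openin_topspace[of "point_space L"] unfolding openin_point_space[OF assms] by blast
  interpret complete_lattice L by (rule assms)
  have "p \<top>" if "lattice_point L p" for p
    using lattice_point_Inf[OF that, of "{}"] weak_inf_empty by (simp add: eq_is_equal)
  then have "openin (point_space L) {p. lattice_point L p}"
    unfolding openin_point_space[OF assms] by blast
  then show "{p. lattice_point L p} \<subseteq> topspace (point_space L)"
    by (rule openin_subset)
qed

lemma compactin_point_open:
  fixes L (structure)
  assumes fr: "frame L" and c: "compact_element L c"
  shows "compactin (point_space L) (point_open L c)"
proof -
  interpret complete_lattice L by (rule frame_complete_lattice[OF fr])
  note opn = openin_point_space[OF complete_lattice_axioms]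
  have cc: "c \<in> carrier L" using c by (rule compact_element_carrier)
  show ?thesis
    unfolding compactin_def
  proof (intro conjI allI impI)
    show "point_open L c \<subseteq> topspace (point_space L)"
      by (auto simp: topspace_point_space[OF complete_lattice_axioms])
    fix \<U> assume U: "(\<forall>U \<in> \<U>. openin (point_space L) U) \<and> point_open L c \<subseteq> \<Union>\<U>"
    let ?S = "{a \<in> carrier L. point_open L a \<in> \<U>}"
    have S: "?S \<subseteq> carrier L" by blast
    have "point_open L c \<subseteq> point_open L (\<Squnion>?S)"
    proof
      fix p assume p: "p \<in> point_open L c"
      with U obtain U where "U \<in> \<U>" "p \<in> U" by blast
      moreover from this U obtain a where "a \<in> carrier L" "U = point_open L a"
        unfolding opn by blast
      ultimately have "a \<in> ?S" "p a" by auto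
      then show "p \<in> point_open L (\<Squnion>?S)"
        using p lattice_point_Sup[OF _ S] by blast
    qed
    then have "c \<sqsubseteq> \<Squnion>?S"
      using point_open_subset_iff[OF fr c sup_closed[OF S]] by blast
    then obtain F where F: "F \<subseteq> ?S" "finite F" "c \<sqsubseteq> \<Squnion>F"
      using compact_elementD[OF c S] by blast
    have FL: "F \<subseteq> carrier L" using F by blast
    have "point_open L c \<subseteq> \<Union>(point_open L ` F)"
    proof
      fix p assume p: "p \<in> point_open L c"
      then have "p (\<Squnion>F)"
        using lattice_point_mono[OF _ cc sup_closed[OF FL] F(3)] by blast
      then show "p \<in> \<Union>(point_open L ` F)"
        using p lattice_point_Sup[OF _ FL] by blast
    qed
    then show "\<exists>\<F>. finite \<F> \<and> \<F> \<subseteq> \<U> \<and> point_open L c \<subseteq> \<Union>\<F>"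
      using F by (intro exI[of _ "point_open L ` F"]) auto
  qed
qed

section \<open>Noetherian Hochster duals\<close>

lemma closedin_hochster_dual_point_open:
  assumes fr: "frame L" and c: "compact_element L c"
  shows "closedin (hochster_dual (point_space L)) (point_open L c)"
proof -
  note cl = frame_complete_lattice[OF fr]
  let ?X = "point_space L"
  have sub: "point_open L c \<subseteq> topspace ?X"
    by (auto simp: topspace_point_space[OF cl])
  have "openin ?X (point_open L c)"
    using c unfolding openin_point_space[OF cl] by (auto dest: compact_element_carrier)
  then have "hochster_basic ?X (topspace ?X - point_open L c)"
    using compactin_point_open[OF assms] sub
    by (auto simp: hochster_basic_def double_diff)
  then show ?thesis
    using sub by (simp add: closedin_def topspace_hochster_dual openin_hochster_dual
        arbitrary_union_of_inc)
qed

lemma noetherian_space_minimal_closed: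
  assumes "noetherian_space X" and cl: "\<And>C. C \<in> \<C> \<Longrightarrow> closedin X C" and "\<C> \<noteq> {}"
  obtains C where "C \<in> \<C>" "\<And>D. \<lbrakk>D \<in> \<C>; D \<subseteq> C\<rbrakk> \<Longrightarrow> D = C"
proof -
  define r where "r = {(D, C). D \<in> \<C> \<and> C \<in> \<C> \<and> D \<subset> C}"
  have "wf r"
    unfolding wf_iff_no_infinite_down_chain
  proof
    assume "\<exists>f. \<forall>i. (f (Suc i), f i) \<in> r"
    then obtain f where "\<forall>i. (f (Suc i), f i) \<in> r" ..
    then have f: "f i \<in> \<C>" "f (Suc i) \<subset> f i" for i by (auto simp: r_def)
    then have "decseq f" by (intro decseq_SucI) (rule psubset_imp_subset)
    moreover have "\<forall>n. closedin X (f n)" using cl f(1) by simp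
    ultimately obtain N where N: "\<forall>n \<ge> N. f n = f N"
      using assms(1) unfolding noetherian_space_def by metis
    have "f (Suc N) = f N" by (rule N[rule_format]) simp
    with f(2)[of N] show False by simp
  qed
  then obtain C where C: "C \<in> \<C>" "\<And>D. (D, C) \<in> r \<Longrightarrow> D \<notin> \<C>"
    using assms(3) by (rule wfE_min') blast
  have "D = C" if "D \<in> \<C>" "D \<subseteq> C" for D
    using that C(1) C(2)[of D] unfolding r_def by blast
  with C(1) show ?thesis by (rule that)
qed

text \<open>
  The generator \<open>c\<close> is the compact element for which \<open>{q | q c}\<close> is the closure of the point \<open>p\<close> in
  the Hochster dual. That this closure, an intersection of such sets, is one of them is what the
  noetherian hypothesis provides.
\<close>

lemma noetherian_point_principal:
  fixes L (structure)
  assumes coh: "coherent_frame L" and noeth: "noetherian_space (hochster_dual (point_space L))"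
    and p: "lattice_point L p"
  obtains c where "compact_element L c" "\<And>a. a \<in> carrier L \<Longrightarrow> p a \<longleftrightarrow> c \<sqsubseteq>\<^bsub>L\<^esub> a"
proof -
  note fr = coherent_frame_frame[OF coh]
  interpret complete_lattice L by (rule frame_complete_lattice[OF fr])
  let ?\<C> = "{point_open L c | c. compact_element L c \<and> p c}"
  \<comment> \<open>Compact elements generate, so they already decide the value of \<open>p\<close>.\<close>
  have below: "\<exists>c. compact_element L c \<and> p c \<and> c \<sqsubseteq> a" if a: "a \<in> carrier L" "p a" for a
  proof -
    obtain S where S: "\<forall>s \<in> S. compact_element L s" "a = \<Squnion>S"
      using coh a unfolding coherent_frame_def by blast
    then have "S \<subseteq> carrier L" by (auto dest: compact_element_carrier)
    moreover from this obtain s where "s \<in> S" "p s"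
      using a S lattice_point_Sup[OF p] by blast
    ultimately show ?thesis using S sup_upper by blast
  qed
  have "p \<top>"
    using lattice_point_Inf[OF p, of "{}"] weak_inf_empty by (simp add: eq_is_equal)
  then have "?\<C> \<noteq> {}" using below[of \<top>] by auto
  then obtain C where "C \<in> ?\<C>" and min: "\<And>D. \<lbrakk>D \<in> ?\<C>; D \<subseteq> C\<rbrakk> \<Longrightarrow> D = C"
    using noetherian_space_minimal_closed[OF noeth, of ?\<C>] closedin_hochster_dual_point_open[OF fr]
    by blast
  then obtain c where c: "compact_element L c" "p c" "C = point_open L c" by blast
  have least: "c \<sqsubseteq> d" if d: "compact_element L d" "p d" for d
  proof -
    have cd: "c \<in> carrier L" "d \<in> carrier L"
      using c d by (auto dest: compact_element_carrier)
    have "p (c \<sqinter> d)"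
      using lattice_point_meet[OF p cd] c d by simp
    then have mem: "point_open L (c \<sqinter> d) \<in> ?\<C>"
      using coherent_frame_meet[OF coh c(1) d(1)] by blast
    have int: "point_open L (c \<sqinter> d) = point_open L c \<inter> point_open L d"
      using lattice_point_meet[OF _ cd] by blast
    have "point_open L (c \<sqinter> d) = C"
      using int c(3) by (intro min[OF mem]) simp
    then have "point_open L c \<subseteq> point_open L d"
      unfolding int c(3) by (simp add: inf.absorb_iff1)
    then show ?thesis
      using point_open_subset_iff[OF fr c(1) cd(2)] by blast
  qed
  have "p a \<longleftrightarrow> c \<sqsubseteq> a" if a: "a \<in> carrier L" for a
  proof
    assume "p a"
    then obtain d where d: "compact_element L d" "p d" "d \<sqsubseteq> a"
      using below a by blast
    then show "c \<sqsubseteq> a"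
      using least a c by (meson compact_element_carrier le_trans)
  next
    assume "c \<sqsubseteq> a"
    then show "p a"
      using lattice_point_mono[OF p _ a] c by (meson compact_element_carrier)
  qed
  then show ?thesis using that c by blast
qed


section \<open>Zero objects\<close>

lemma (in additive_category) hadd_closed:
  assumes "f \<in> homset C X Y" "g \<in> homset C X Y"
  shows "hadd C f g \<in> homset C X Y"
proof -
  have "X \<in> Obj C" "Y \<in> Obj C"
    using assms src_closed tgt_closed unfolding homset_def by auto
  then interpret comm_group "hom_group C X Y" by (rule hom_comm_group)
  show ?thesis using m_closed assms by (simp add: hom_group_def)
qed

lemma (in additive_category) hadd_idem_eq_zero:
  assumes "f \<in> homset C X Y" "hadd C f f = f"
  shows "f = hzero C X Y"
proof -
  have "X \<in> Obj C" "Y \<in> Obj C"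
    using assms src_closed tgt_closed unfolding homset_def by auto
  then interpret comm_group "hom_group C X Y" by (rule hom_comm_group)
  show ?thesis using l_cancel_one[of f f] assms by (simp add: hom_group_def)
qed

lemma (in additive_category) hneg_idem_imp_idem:
  assumes f: "f \<in> homset C X Y" and "hadd C (hneg C f) (hneg C f) = hneg C f"
  shows "hadd C f f = f"
proof -
  have "X \<in> Obj C" "Y \<in> Obj C"
    using assms src_closed tgt_closed unfolding homset_def by auto
  then interpret comm_group "hom_group C X Y" by (rule hom_comm_group)
  have n: "hneg C f = inv\<^bsub>hom_group C X Y\<^esub> f"
    using f by (auto simp: hneg_def homset_def)
  have fc: "f \<in> carrier (hom_group C X Y)" using f by (simp add: hom_group_def)
  have m: "monoid.mult (hom_group C X Y) = hadd C" by (simp add: hom_group_def)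
  have "inv\<^bsub>hom_group C X Y\<^esub> f = \<one>\<^bsub>hom_group C X Y\<^esub>"
    using assms(2)[folded m] fc unfolding n by simp
  then have "f = \<one>\<^bsub>hom_group C X Y\<^esub>" using fc by (metis inv_inv inv_one)
  then have "f \<otimes>\<^bsub>hom_group C X Y\<^esub> f = f" by simp
  then show ?thesis by (simp add: m)
qed

lemma (in additive_category) hneg_closed:
  assumes "f \<in> homset C X Y"
  shows "hneg C f \<in> homset C X Y"
proof -
  have "X \<in> Obj C" "Y \<in> Obj C"
    using assms src_closed tgt_closed unfolding homset_def by auto
  then interpret comm_group "hom_group C X Y" by (rule hom_comm_group)
  show ?thesis using assms inv_closed[of f] by (auto simp: hneg_def homset_def hom_group_def)
qed

lemma (in additive_category) zero_object_hom_to_idem: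
  assumes Z: "zero_object C Z" and f: "f \<in> homset C X Z"
  shows "hadd C f f = f"
proof -
  have "X \<in> Obj C" using f src_closed unfolding homset_def by auto
  then show ?thesis using Z f hadd_closed[OF f f] unfolding zero_object_def by blast
qed

text \<open>
  An idempotent of a group is neutral, so the condition says that the identity of \<open>Z\<close> is the zero
  morphism. Stated as an idempotence it is visibly preserved and reflected by the suspension, and it
  holds for every morphism that factors through a zero object.
\<close>

lemma (in additive_category) zero_object_iff:
  "zero_object C Z \<longleftrightarrow> Z \<in> Obj C \<and> hadd C (ident C Z) (ident C Z) = ident C Z"
proof
  assume "zero_object C Z"
  then show "Z \<in> Obj C \<and> hadd C (ident C Z) (ident C Z) = ident C Z"
    using zero_object_hom_to_idem ident_hom unfolding zero_object_def by blast
next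
  assume Z: "Z \<in> Obj C \<and> hadd C (ident C Z) (ident C Z) = ident C Z"
  then have id: "ident C Z \<in> homset C Z Z" by (simp add: ident_hom)
  have ze: "hzero C X Y \<in> homset C X Y" if "X \<in> Obj C" "Y \<in> Obj C" for X Y
  proof -
    interpret comm_group "hom_group C X Y" using that by (rule hom_comm_group)
    show ?thesis using one_closed by (simp add: hom_group_def)
  qed
  have "f = hzero C X Z" if f: "f \<in> homset C X Z" for f X
    using compo_hadd_left[OF f id id] Z f by (intro hadd_idem_eq_zero) (simp_all add: ident_left)
  moreover have "f = hzero C Z X" if f: "f \<in> homset C Z X" for f X
    using compo_hadd_right[OF id id f] Z f by (intro hadd_idem_eq_zero) (simp_all add: ident_right)
  ultimately show "zero_object C Z"
    using Z ze unfolding zero_object_def by blast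
qed

lemma (in additive_category) hom_through_zero_idem:
  assumes "zero_object C Z" "w \<in> homset C X Z" "b \<in> homset C Z Y"
  shows "hadd C (b \<cdot> w) (b \<cdot> w) = b \<cdot> w"
  using compo_hadd_right[OF assms(2,2,3)] zero_object_hom_to_idem[OF assms(1,2)] by simp

lemma (in additive_category) retract_zero_object:
  assumes "zero_object C Z" "w \<in> homset C X Z" "b \<in> homset C Z X" "b \<cdot> w = ident C X"
  shows "zero_object C X"
  using hom_through_zero_idem[OF assms(1-3)] assms src_closed
  unfolding zero_object_iff[of X] homset_def by auto

lemma (in triangulated_category) zero_object_susp_iff:
  assumes X: "X \<in> Obj K"
  shows "zero_object K (susp K X) \<longleftrightarrow> zero_object K X"
proof -
  have id: "ident K X \<in> homset K X X" using X by (rule ident_hom)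
  have inj: "inj_on (sarr K) (homset K X X)"
    using sarr_bij[OF X X] by (rule bij_betw_imp_inj_on)
  show ?thesis
    using X id inj_on_eq_iff[OF inj hadd_closed[OF id id] id]
    by (simp add: zero_object_iff susp_closed sarr_hadd[OF id id] sarr_ident[symmetric])
qed

text \<open>
  Let \<open>X \<rightarrow> Y \<rightarrow> Z \<rightarrow> \<Sigma>X\<close> be distinguished with \<open>X\<close> and \<open>Y\<close> zero. The identity of \<open>Z\<close> starts a morphism
  from the rotation \<open>Z \<rightarrow> 0 \<rightarrow> \<Sigma>Z \<rightarrow> \<Sigma>Z\<close> of the trivial triangle to \<open>Z \<rightarrow> \<Sigma>X \<rightarrow> \<Sigma>Y \<rightarrow> \<Sigma>Z\<close>, since the first
  square commutes for lack of nonzero maps to \<open>\<Sigma>X\<close>. The last square factors \<open>-id\<close> on \<open>\<Sigma>Z\<close> through the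
  zero object \<open>\<Sigma>Y\<close>, so \<open>\<Sigma>Z\<close> is zero, and so is \<open>Z\<close>.
\<close>

lemma (in triangulated_category) cone_zero_object:
  assumes d: "(f, g, h) \<in> dist K" and zero: "zero_object K (src K f)" "zero_object K (tgt K f)"
  shows "zero_object K (tgt K g)"
proof -
  define X Y Z where "X = src K f" and "Y = tgt K f" and "Z = tgt K g"
  have tri: "triangle K f g h" using d by (rule dist_triangle)
  then have hom: "f \<in> homset K X Y" "g \<in> homset K Y Z" "h \<in> homset K Z (susp K X)"
    unfolding triangle_def homset_def X_def Y_def Z_def by auto
  then have obj: "X \<in> Obj K" "Y \<in> Obj K" "Z \<in> Obj K"
    using src_closed tgt_closed unfolding homset_def by auto
  obtain O' where O: "zero_object K O'" using zero_object_exists by blast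
  have sarr_hom: "sarr K u \<in> homset K (susp K A) (susp K B)" if "u \<in> homset K A B" for u A B
  proof -
    have "A \<in> Obj K" "B \<in> Obj K" using that src_closed tgt_closed unfolding homset_def by auto
    from bij_betwE[OF sarr_bij[OF this]] that show ?thesis by blast
  qed
  define z where "z = hzero K Z O'"
  define z' where "z' = hzero K O' (susp K Z)"
  have d0: "(ident K Z, z, z') \<in> dist K"
    unfolding z_def z'_def using obj O by (intro dist_ident)
  then have d1: "(z, z', hneg K (sarr K (ident K Z))) \<in> dist K"
    using dist_rotate dist_triangle by blast
  have d2: "(h, hneg K (sarr K f), hneg K (sarr K g)) \<in> dist K"
    using d dist_rotate dist_triangle by blast
  have tri0: "triangle K (ident K Z) z z'" using d0 by (rule dist_triangle)
  have idZ: "ident K Z \<in> homset K Z Z" using obj by (intro ident_hom)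
  have zZ: "z \<in> homset K Z (tgt K z)" "z' \<in> homset K (tgt K z) (susp K Z)"
    using tri0 idZ unfolding triangle_def homset_def by auto
  have zX: "zero_object K (susp K X)" and zY: "zero_object K (susp K Y)"
    using zero obj zero_object_susp_iff unfolding X_def Y_def by blast+
  have srcs: "src K (hneg K (sarr K f)) = susp K X" "src K (hneg K (sarr K g)) = susp K Y"
    "src K h = Z" "src K z = Z" "src K z' = tgt K z"
    using hneg_closed[OF sarr_hom[OF hom(1)]] hneg_closed[OF sarr_hom[OF hom(2)]] hom zZ
    unfolding homset_def by auto
  have tO: "tgt K z \<in> Obj K" using zZ tgt_closed unfolding homset_def by blast
  then obtain v where v: "v \<in> homset K (tgt K z) (susp K X)"
    using zX unfolding zero_object_def by blast
  have "v \<cdot> z = h \<cdot> ident K Z"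
    using zX obj compo_hom[OF zZ(1) v] compo_hom[OF idZ hom(3)] unfolding zero_object_def by blast
  then obtain w where "triangle_morphism K (z, z', hneg K (sarr K (ident K Z)))
      (h, hneg K (sarr K f), hneg K (sarr K g)) (ident K Z) v w"
    using dist_morphism[OF d1 d2, of "ident K Z" v] idZ v srcs by auto
  then have w: "w \<in> homset K (src K (hneg K (sarr K (ident K Z)))) (susp K Y)"
    "sarr K (ident K Z) \<cdot> hneg K (sarr K (ident K Z)) = hneg K (sarr K g) \<cdot> w"
    using srcs unfolding triangle_morphism_def by auto
  let ?i = "ident K (susp K Z)"
  have i: "?i \<in> homset K (susp K Z) (susp K Z)" using obj by (intro ident_hom susp_closed)
  have ni: "hneg K ?i \<in> homset K (susp K Z) (susp K Z)" using i by (rule hneg_closed)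
  have "hneg K ?i = hneg K (sarr K g) \<cdot> w"
    using w(2) ni obj by (simp add: sarr_ident ident_left)
  moreover have "w \<in> homset K (susp K Z) (susp K Y)"
    using w(1) ni obj by (simp add: sarr_ident homset_def)
  ultimately have "hadd K (hneg K ?i) (hneg K ?i) = hneg K ?i"
    using hom_through_zero_idem[OF zY _ hneg_closed[OF sarr_hom[OF hom(2)]]] by simp
  then have "hadd K ?i ?i = ?i" by (rule hneg_idem_imp_idem[OF i])
  then have "zero_object K (susp K Z)"
    using obj by (simp add: zero_object_iff susp_closed)
  then show ?thesis using obj zero_object_susp_iff unfolding Z_def by blast
qed

lemma (in triangulated_category) thick_zero_objects:
  "thick_subcategory K {X. zero_object K X}"
  unfolding thick_subcategory_def
proof (intro conjI allI ballI impI)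
  show "{X. zero_object K X} \<subseteq> Obj K" by (auto simp: zero_object_def)
  show "Z \<in> {X. zero_object K X}" if "zero_object K Z" for Z using that by simp
  show "Y \<in> {X. zero_object K X}" if XY: "X \<in> {X. zero_object K X}" "isomorphic_objs K X Y" for X Y
  proof -
    from XY obtain f g where "f \<in> homset K X Y" "g \<in> homset K Y X" "f \<cdot> g = ident K Y"
      unfolding isomorphic_objs_def is_iso_def homset_def by auto
    with XY show ?thesis using retract_zero_object[of X g Y f] by simp
  qed
  show "X \<in> {X. zero_object K X} \<longleftrightarrow> susp K X \<in> {X. zero_object K X}" if "X \<in> Obj K" for X
    using that by (simp add: zero_object_susp_iff)
  show "tgt K g \<in> {X. zero_object K X}"
    if "(f, g, h) \<in> dist K \<and> src K f \<in> {X. zero_object K X} \<and> tgt K f \<in> {X. zero_object K X}"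
    for f g h
    using that cone_zero_object by blast
  show "X \<in> {X. zero_object K X}" if "W \<in> {X. zero_object K X}" "direct_summand K X W" for W X
    using that retract_zero_object unfolding direct_summand_def is_biproduct_def by auto
qed


section \<open>Compact thick subcategories and Matsui's points\<close>

context triangulated_category
begin

lemma thick_thick: "X \<in> Obj K \<Longrightarrow> thick_subcategory K (thick K X)"
  by (simp add: thick_closure_thick)

lemma thick_subset_iff:
  "thick_subcategory K M \<Longrightarrow> thick K X \<subseteq> M \<longleftrightarrow> X \<in> M"
  unfolding thick_closure_def by auto

text \<open>
  Closure under cones involves two objects at a time, and this is where directedness enters.
\<close>

lemma thick_directed_Union:
  assumes "\<M> \<noteq> {}" and T: "\<And>M. M \<in> \<M> \<Longrightarrow> thick_subcategory K M"
    and dir: "\<And>M N. \<lbrakk>M \<in> \<M>; N \<in> \<M>\<rbrakk> \<Longrightarrow> \<exists>P \<in> \<M>. M \<union> N \<subseteq> P"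
  shows "thick_subcategory K (\<Union>\<M>)"
  unfolding thick_subcategory_def
proof (intro conjI allI ballI impI)
  note D = T[unfolded thick_subcategory_def]
  show "\<Union>\<M> \<subseteq> Obj K" using D by blast
  show "Z \<in> \<Union>\<M>" if "zero_object K Z" for Z using that D assms(1) by blast
  show "Y \<in> \<Union>\<M>" if XY: "X \<in> \<Union>\<M>" "Y \<in> Obj K" "isomorphic_objs K X Y" for X Y
  proof -
    from XY(1) obtain M where "M \<in> \<M>" "X \<in> M" by blast
    with D[OF this(1)] XY show ?thesis by blast
  qed
  show "X \<in> \<Union>\<M> \<longleftrightarrow> susp K X \<in> \<Union>\<M>" if "X \<in> Obj K" for X
  proof -
    have "X \<in> M \<longleftrightarrow> susp K X \<in> M" if "M \<in> \<M>" for M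
      using D[OF that] \<open>X \<in> Obj K\<close> by blast
    then show ?thesis by blast
  qed
  show "tgt K g \<in> \<Union>\<M>" if H: "(f, g, h) \<in> dist K \<and> src K f \<in> \<Union>\<M> \<and> tgt K f \<in> \<Union>\<M>" for f g h
  proof -
    from H obtain M N where "M \<in> \<M>" "N \<in> \<M>" "src K f \<in> M" "tgt K f \<in> N" by blast
    with dir[of M N] obtain P where "P \<in> \<M>" "src K f \<in> P" "tgt K f \<in> P" by blast
    with D[OF this(1)] H show ?thesis by blast
  qed
  show "X \<in> \<Union>\<M>" if WX: "W \<in> \<Union>\<M>" "direct_summand K X W" for W X
  proof -
    from WX(1) obtain M where "M \<in> \<M>" "W \<in> M" by blast
    with D[OF this(1)] WX show ?thesis by blast
  qed
qed

text \<open>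
  The joins of the finite subfamilies of \<open>S\<close> form a directed family, so their union is thick and is
  the join of \<open>S\<close>; an object of this join therefore lies in one of the finite joins.
\<close>

lemma compact_thick:
  assumes k: "k \<in> Obj K"
  shows "compact_element (thick_lattice K) (thick K k)"
  unfolding compact_element_def
proof (intro conjI allI impI)
  interpret L: complete_lattice "thick_lattice K" by (rule complete_lattice_thick_lattice)
  let ?L = "thick_lattice K"
  show "thick K k \<in> carrier ?L" using thick_thick[OF k] by simp
  fix S assume S: "S \<subseteq> carrier ?L" and le: "thick K k \<sqsubseteq>\<^bsub>?L\<^esub> \<Squnion>\<^bsub>?L\<^esub>S"
  let ?M = "{\<Squnion>\<^bsub>?L\<^esub>F | F. F \<subseteq> S \<and> finite F}"
  have mono: "\<Squnion>\<^bsub>?L\<^esub>F \<subseteq> \<Squnion>\<^bsub>?L\<^esub>G" if "F \<subseteq> G" "G \<subseteq> S" for F G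
  proof -
    have "F \<subseteq> carrier ?L" "G \<subseteq> carrier ?L" using that S by blast+
    then have "\<Squnion>\<^bsub>?L\<^esub>F \<sqsubseteq>\<^bsub>?L\<^esub> \<Squnion>\<^bsub>?L\<^esub>G"
      using that by (intro L.sup_least L.sup_closed L.sup_upper) auto
    then show ?thesis by simp
  qed
  have "thick_subcategory K (\<Union>?M)"
  proof (rule thick_directed_Union)
    show "?M \<noteq> {}" by blast
    show "thick_subcategory K M" if M: "M \<in> ?M" for M
    proof -
      from M obtain F where F: "M = \<Squnion>\<^bsub>?L\<^esub>F" "F \<subseteq> S" by blast
      then have "F \<subseteq> carrier ?L" using S by blast
      then show ?thesis using L.sup_closed[of F] F by simp
    qed
    show "\<exists>P \<in> ?M. M \<union> N \<subseteq> P" if MN: "M \<in> ?M" "N \<in> ?M" for M N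
    proof -
      from MN obtain F G where FG: "M = \<Squnion>\<^bsub>?L\<^esub>F" "N = \<Squnion>\<^bsub>?L\<^esub>G" "F \<subseteq> S" "G \<subseteq> S" "finite F" "finite G"
        by blast
      then have "M \<union> N \<subseteq> \<Squnion>\<^bsub>?L\<^esub>(F \<union> G)"
        using mono[of F "F \<union> G"] mono[of G "F \<union> G"] by blast
      moreover have "\<Squnion>\<^bsub>?L\<^esub>(F \<union> G) \<in> ?M" using FG by blast
      ultimately show ?thesis by blast
    qed
  qed
  moreover have "s \<subseteq> \<Union>?M" if s: "s \<in> S" for s
  proof -
    have "s \<sqsubseteq>\<^bsub>?L\<^esub> \<Squnion>\<^bsub>?L\<^esub>{s}" using s S by (intro L.sup_upper) auto
    moreover have "\<Squnion>\<^bsub>?L\<^esub>{s} \<in> ?M" using s by blast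
    ultimately show ?thesis by auto
  qed
  ultimately have "\<Squnion>\<^bsub>?L\<^esub>S \<sqsubseteq>\<^bsub>?L\<^esub> \<Union>?M"
    using S by (intro L.sup_least) auto
  moreover have "\<Squnion>\<^bsub>?L\<^esub>S \<in> carrier ?L" using S by (rule L.sup_closed)
  moreover from this have "k \<in> \<Squnion>\<^bsub>?L\<^esub>S" using le thick_subset_iff by simp
  ultimately obtain F where F: "F \<subseteq> S" "finite F" "k \<in> \<Squnion>\<^bsub>?L\<^esub>F" by auto
  moreover have "\<Squnion>\<^bsub>?L\<^esub>F \<in> carrier ?L" using F S by (intro L.sup_closed) blast
  ultimately show "\<exists>F \<subseteq> S. finite F \<and> thick K k \<sqsubseteq>\<^bsub>?L\<^esub> \<Squnion>\<^bsub>?L\<^esub>F"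
    using thick_subset_iff by (intro exI[of _ F]) simp
qed

lemma Sup_thick_objects:
  assumes M: "thick_subcategory K M"
  shows "\<Squnion>\<^bsub>thick_lattice K\<^esub>(thick K ` M) = M"
proof -
  interpret L: complete_lattice "thick_lattice K" by (rule complete_lattice_thick_lattice)
  let ?L = "thick_lattice K"
  have sub: "thick K ` M \<subseteq> carrier ?L"
    using thick_subcategory_subset[OF M] thick_thick by auto
  have "\<Squnion>\<^bsub>?L\<^esub>(thick K ` M) \<sqsubseteq>\<^bsub>?L\<^esub> M"
    using sub M thick_subset_iff[OF M] by (intro L.sup_least) auto
  moreover have "x \<in> \<Squnion>\<^bsub>?L\<^esub>(thick K ` M)" if "x \<in> M" for x
  proof -
    have "thick K x \<sqsubseteq>\<^bsub>?L\<^esub> \<Squnion>\<^bsub>?L\<^esub>(thick K ` M)"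
      using that sub by (intro L.sup_upper) auto
    then show ?thesis
      using L.sup_closed[OF sub] thick_subset_iff by simp
  qed
  ultimately show ?thesis by auto
qed

lemma thick_bottom: "\<bottom>\<^bsub>thick_lattice K\<^esub> = {X. zero_object K X}"
proof -
  interpret L: complete_lattice "thick_lattice K" by (rule complete_lattice_thick_lattice)
  have "\<bottom>\<^bsub>thick_lattice K\<^esub> \<sqsubseteq>\<^bsub>thick_lattice K\<^esub> {X. zero_object K X}"
    using thick_zero_objects by (intro L.bottom_lower) simp
  moreover have "{X. zero_object K X} \<subseteq> \<bottom>\<^bsub>thick_lattice K\<^esub>"
    using L.bottom_closed by (auto simp: thick_subcategory_def)
  ultimately show ?thesis by auto
qed

lemma join_prime_not_le_bottom:
  assumes "join_prime K J"
  shows "\<not> J \<subseteq> {X. zero_object K X}"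
proof -
  have "J \<noteq> {X. zero_object K X}" and "thick_subcategory K J"
    using assms by (simp_all add: join_prime_def)
  then show ?thesis by (auto simp: thick_subcategory_def)
qed

lemma join_prime_lattice_point:
  assumes J: "J \<in> MSpc_points K"
  shows "lattice_point (thick_lattice K) (\<lambda>M \<in> carrier (thick_lattice K). J \<sqsubseteq>\<^bsub>thick_lattice K\<^esub> M)"
proof (rule lattice_point_of_join_prime[OF complete_lattice_thick_lattice])
  from J obtain k where k: "k \<in> Obj K" "J = thick K k" and jp: "join_prime K J"
    unfolding MSpc_points_def by blast
  then show "compact_element (thick_lattice K) J" using compact_thick by simp
  show "\<not> J \<sqsubseteq>\<^bsub>thick_lattice K\<^esub> \<bottom>\<^bsub>thick_lattice K\<^esub>"
    using join_prime_not_le_bottom[OF jp] thick_bottom by simp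
  show "J \<sqsubseteq>\<^bsub>thick_lattice K\<^esub> M \<or> J \<sqsubseteq>\<^bsub>thick_lattice K\<^esub> N"
    if "M \<in> carrier (thick_lattice K)" "N \<in> carrier (thick_lattice K)"
      "J \<sqsubseteq>\<^bsub>thick_lattice K\<^esub> M \<squnion>\<^bsub>thick_lattice K\<^esub> N" for M N
    using jp that unfolding join_prime_def by simp
qed

text \<open>
  The point preserves the join of all \<open>thick(k)\<close> with \<open>k \<in> J\<close>, which is \<open>J\<close>, so it holds at some
  \<open>thick(k)\<close>, giving \<open>J \<subseteq> thick(k) \<subseteq> J\<close>. This is how a single generator of \<open>J\<close> is found.
\<close>

lemma lattice_point_join_prime:
  assumes p: "lattice_point (thick_lattice K) p" and J: "compact_element (thick_lattice K) J"
    and eq: "\<And>M. thick_subcategory K M \<Longrightarrow> p M \<longleftrightarrow> J \<subseteq> M"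
  shows "J \<in> MSpc_points K"
proof -
  interpret L: complete_lattice "thick_lattice K" by (rule complete_lattice_thick_lattice)
  let ?L = "thick_lattice K"
  have JT: "thick_subcategory K J" using compact_element_carrier[OF J] by simp
  then have pJ: "p J" using eq by simp
  have "\<not> p \<bottom>\<^bsub>?L\<^esub>"
    using lattice_point_Sup[OF p, of "{}"] L.weak_sup_empty by simp
  then have "J \<noteq> {X. zero_object K X}" using pJ thick_bottom by auto
  moreover have "J \<subseteq> M \<or> J \<subseteq> N"
    if MN: "thick_subcategory K M" "thick_subcategory K N" "J \<subseteq> M \<squnion>\<^bsub>?L\<^esub> N" for M N
  proof -
    have "M \<squnion>\<^bsub>?L\<^esub> N \<in> carrier ?L" using MN by (intro L.join_closed) auto
    then have "p (M \<squnion>\<^bsub>?L\<^esub> N)" using MN eq by simp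
    then show ?thesis using lattice_point_join[OF p, of M N] MN eq by simp
  qed
  ultimately have "join_prime K J" using JT unfolding join_prime_def by blast
  moreover obtain k where k: "k \<in> J" "p (thick K k)"
  proof -
    have "thick K ` J \<subseteq> carrier ?L"
      using thick_subcategory_subset[OF JT] thick_thick by auto
    then show ?thesis
      using that pJ lattice_point_Sup[OF p, of "thick K ` J"] Sup_thick_objects[OF JT] by auto
  qed
  moreover have "k \<in> Obj K" using k thick_subcategory_subset[OF JT] by blast
  moreover have "J = thick K k"
    using k eq[OF thick_thick[OF \<open>k \<in> Obj K\<close>]] thick_subset_iff[OF JT] by blast
  ultimately show ?thesis unfolding MSpc_points_def by blast
qed

text \<open>
  The union of the generating open sets is everything because \<open>Z\<^sub>0\<close> is empty: no join-prime lies in the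
  subcategory of zero objects.
\<close>

lemma topspace_MSpc: "topspace (MSpc K) = MSpc_points K"
proof -
  obtain O' where O: "zero_object K O'" using zero_object_exists by blast
  then have "MSpc_basic_closed K O' = {}"
    using thick_subset_iff[OF thick_zero_objects] join_prime_not_le_bottom
    unfolding MSpc_basic_closed_def MSpc_points_def by blast
  then have "MSpc_points K \<in> {MSpc_points K - MSpc_basic_closed K x | x. x \<in> Obj K}"
    using O unfolding zero_object_def by blast
  then show ?thesis unfolding MSpc_def topology_generated_by_topspace by blast
qed

text \<open>
  \<open>M\<close> is the join of the \<open>thick(x)\<close> with \<open>x \<in> M\<close>, so these give an open cover.
\<close>

lemma compactin_Spcnt_finite_objects:
  assumes M: "thick_subcategory K M" and cpt: "compactin (Spcnt K) (point_open (thick_lattice K) M)"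
  obtains F where "finite F" "F \<subseteq> M"
    "point_open (thick_lattice K) M = (\<Union>x \<in> F. point_open (thick_lattice K) (thick K x))"
proof -
  let ?L = "thick_lattice K"
  let ?U = "\<lambda>x. point_open ?L (thick K x)"
  have sub: "thick K ` M \<subseteq> carrier ?L"
    using thick_subcategory_subset[OF M] thick_thick by auto
  have eq: "point_open ?L M = (\<Union>x \<in> M. ?U x)"
    using lattice_point_Sup[OF _ sub] Sup_thick_objects[OF M] by auto
  have "openin (Spcnt K) (?U x)" if "x \<in> M" for x
    unfolding Spcnt_def openin_point_space[OF complete_lattice_thick_lattice]
    using that sub by blast
  then obtain \<F> where \<F>: "finite \<F>" "\<F> \<subseteq> ?U ` M" "point_open ?L M \<subseteq> \<Union>\<F>"
    using cpt[unfolded compactin_def, THEN conjunct2, rule_format, of "?U ` M"] eq by auto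
  obtain F where F: "F \<subseteq> M" "finite F" "\<F> = ?U ` F"
    using finite_subset_image[OF \<F>(1,2)] by blast
  have "point_open ?L M = (\<Union>x \<in> F. ?U x)"
  proof
    show "point_open ?L M \<subseteq> (\<Union>x \<in> F. ?U x)" using \<F>(3) unfolding F(3) .
    show "(\<Union>x \<in> F. ?U x) \<subseteq> point_open ?L M" unfolding eq using F(1) by (rule UN_mono) simp
  qed
  with F(2,1) show ?thesis by (rule that)
qed

lemma openin_MSpc_Diff_basic_closed:
  assumes "finite F" "F \<subseteq> Obj K"
  shows "openin (MSpc K) (MSpc_points K - (\<Union>x \<in> F. MSpc_basic_closed K x))"
proof -
  have "closedin (MSpc K) (MSpc_basic_closed K x)" if "x \<in> F" for x
  proof -
    have "openin (MSpc K) (MSpc_points K - MSpc_basic_closed K x)"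
      unfolding MSpc_def using that assms by (intro topology_generated_by_Basis) blast
    then show ?thesis
      unfolding closedin_def topspace_MSpc by (auto simp: MSpc_basic_closed_def)
  qed
  then have "closedin (MSpc K) (\<Union>x \<in> F. MSpc_basic_closed K x)"
    using assms by (intro closedin_Union) auto
  then show ?thesis unfolding closedin_def topspace_MSpc by blast
qed

end


section \<open>The homeomorphism\<close>

theorem theorem6p3p3:
  fixes K :: "('o, 'a) tricat"
  assumes "triangulated_category K"
    and "coherent_frame (thick_lattice K)"
    and "noetherian_space (hochster_dual (Spcnt K))"
  shows "MSpc K homeomorphic_space hochster_dual (Spcnt K)"
proof -
  interpret triangulated_category K by (rule assms(1))
  let ?L = "thick_lattice K" and ?X = "Spcnt K"
  note cl = complete_lattice_thick_lattice
  note fr = coherent_frame_frame[OF assms(2)]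
  \<comment> \<open>\<open>up J\<close> is the point with principal filter generated by \<open>J\<close>, and \<open>dn\<close> recovers the generator.\<close>
  define up where "up J = (\<lambda>M \<in> carrier ?L. J \<sqsubseteq>\<^bsub>?L\<^esub> M)" for J
  have up: "lattice_point ?L (up J)" if "J \<in> MSpc_points K" for J
    unfolding up_def using that by (rule join_prime_lattice_point)
  have up_apply: "up J M \<longleftrightarrow> J \<subseteq> M" if "thick_subcategory K M" for J M
    using that by (simp add: up_def)
  have top: "topspace (hochster_dual ?X) = {p. lattice_point ?L p}"
    by (simp add: topspace_hochster_dual Spcnt_def topspace_point_space[OF cl])
  have thickJ: "thick_subcategory K J" if "J \<in> MSpc_points K" for J
    using that by (simp add: MSpc_points_def join_prime_def)
  have inj: "inj_on up (MSpc_points K)"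
  proof (rule inj_onI)
    fix I J assume "I \<in> MSpc_points K" "J \<in> MSpc_points K" "up I = up J"
    then show "I = J" using up_apply thickJ by (metis order_refl subset_antisym)
  qed
  have surj: "up ` MSpc_points K = {p. lattice_point ?L p}"
  proof (intro subset_antisym subsetI)
    fix p assume "p \<in> {p. lattice_point ?L p}"
    then have p: "lattice_point ?L p" by simp
    obtain J where J: "compact_element ?L J" "\<And>M. M \<in> carrier ?L \<Longrightarrow> p M \<longleftrightarrow> J \<sqsubseteq>\<^bsub>?L\<^esub> M"
      using noetherian_point_principal[OF assms(2) assms(3)[unfolded Spcnt_def] p] by blast
    then have "J \<in> MSpc_points K" using lattice_point_join_prime[OF p] by simp
    moreover have "p = up J"
    proof
      fix M show "p M = up J M"
        using p J(2)[of M] unfolding up_def lattice_point_def extensional_def by auto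
    qed
    ultimately show "p \<in> up ` MSpc_points K" by blast
  qed (use up in auto)
  define dn where "dn = inv_into (MSpc_points K) up"
  have dn: "dn p \<in> MSpc_points K" "up (dn p) = p" if "lattice_point ?L p" for p
    using that surj unfolding dn_def by (metis inv_into_into mem_Collect_eq, metis f_inv_into_f mem_Collect_eq)
  \<comment> \<open>The bijection matches the two families of closed sets, which makes it bicontinuous.\<close>
  have pre: "J \<in> MSpc_basic_closed K x \<longleftrightarrow> up J \<in> point_open ?L (thick K x)"
    if "J \<in> MSpc_points K" "x \<in> Obj K" for J x
    using that up up_apply[OF thick_thick] by (simp add: MSpc_basic_closed_def)
  have "continuous_map (MSpc K) (hochster_dual ?X) up"
  proof (rule continuous_map_into_topology_base)
    show "openin (hochster_dual ?X) = arbitrary union_of hochster_basic ?X"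
      by (rule openin_hochster_dual)
    show "up J \<in> topspace (hochster_dual ?X)" if "J \<in> topspace (MSpc K)" for J
      using that up topspace_MSpc top by simp
    fix C assume C: "hochster_basic ?X C"
    then have "openin ?X (topspace ?X - C)" unfolding hochster_basic_def by blast
    then obtain M where M: "thick_subcategory K M" "topspace ?X - C = point_open ?L M"
      unfolding Spcnt_def openin_point_space[OF cl] by auto
    then have "compactin ?X (point_open ?L M)"
      using C unfolding hochster_basic_def by simp
    then obtain F where F: "finite F" "F \<subseteq> M"
      "point_open ?L M = (\<Union>x \<in> F. point_open ?L (thick K x))"
      using compactin_Spcnt_finite_objects M by blast
    then have FO: "F \<subseteq> Obj K" using thick_subcategory_subset M by blast
    have CM: "p \<in> C \<longleftrightarrow> p \<notin> point_open ?L M" if "lattice_point ?L p" for p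
    proof -
      have "p \<in> topspace ?X" using that top by (simp add: topspace_hochster_dual)
      then show ?thesis unfolding M(2)[symmetric] by simp
    qed
    have "{J \<in> topspace (MSpc K). up J \<in> C} = MSpc_points K - (\<Union>x \<in> F. MSpc_basic_closed K x)"
    proof (rule Set.set_eqI)
      fix J
      have "up J \<in> C \<longleftrightarrow> J \<notin> (\<Union>x \<in> F. MSpc_basic_closed K x)" if "J \<in> MSpc_points K"
        using CM[OF up[OF that]] pre[OF that] FO unfolding F(3) by (simp add: subset_iff)
      then show "J \<in> {J \<in> topspace (MSpc K). up J \<in> C}
          \<longleftrightarrow> J \<in> MSpc_points K - (\<Union>x \<in> F. MSpc_basic_closed K x)"
        unfolding topspace_MSpc by auto
    qed
    then show "openin (MSpc K) {J \<in> topspace (MSpc K). up J \<in> C}"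
      using openin_MSpc_Diff_basic_closed[OF F(1) FO] by simp
  qed
  moreover have "continuous_map (hochster_dual ?X) (MSpc K) dn"
    unfolding MSpc_def
  proof (rule continuous_on_generated_topo)
    show "dn ` topspace (hochster_dual ?X) \<subseteq> \<Union>{MSpc_points K - MSpc_basic_closed K x | x. x \<in> Obj K}"
      using dn(1) top topspace_MSpc unfolding MSpc_def topology_generated_by_topspace by auto
    fix U assume "U \<in> {MSpc_points K - MSpc_basic_closed K x | x. x \<in> Obj K}"
    then obtain x where x: "x \<in> Obj K" "U = MSpc_points K - MSpc_basic_closed K x" by blast
    have "dn -` U \<inter> topspace (hochster_dual ?X)
        = topspace (hochster_dual ?X) - point_open ?L (thick K x)"
      using pre[OF dn(1) x(1)] dn unfolding x(2) top by auto
    then show "openin (hochster_dual ?X) (dn -` U \<inter> topspace (hochster_dual ?X))"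
      using closedin_hochster_dual_point_open[OF fr compact_thick[OF x(1)]]
      unfolding Spcnt_def closedin_def by simp
  qed
  moreover have "\<forall>J \<in> topspace (MSpc K). dn (up J) = J"
    unfolding dn_def topspace_MSpc using inj by simp
  moreover have "\<forall>p \<in> topspace (hochster_dual ?X). up (dn p) = p"
    using dn(2) top by simp
  ultimately have "homeomorphic_maps (MSpc K) (hochster_dual ?X) up dn"
    unfolding homeomorphic_maps_def by blast
  then show ?thesis unfolding homeomorphic_space_def by blast
qed

end
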